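(* There is an infinite class $\Phi$ of CNFs such that every $\varphi \in \Phi$ can be represented by an FBDD of size polynomial in $|\mathsf{var}(\varphi)|$, while every $\wedge_d$-OBDD representing $\varphi$ has size exponential in a power of $|\mathsf{var}(\varphi)|$, i.e. at least $2^{\Omega(|\mathsf{var}(\varphi)|^{c})}$ for some absolute constant $c>0$.
   Context: An assignment ${\bf a}$ is a map from a finite set of variables $\mathsf{var}({\bf a})$ to $\{0,1\}$, identified with the set of pairs $(x,{\bf a}(x))$. For sets $\mathcal{H}_1,\mathcal{H}_2$ of assignments over disjoint variable sets, $\mathcal{H}_1\times\mathcal{H}_2=\{{\bf a}\cup{\bf b}: {\bf a}\in\mathcal{H}_1,{\bf b}\in\mathcal{H}_2\}$. A $\wedge_d$-FBDD is a directed acyclic graph $B$ with a single source and two sinks labelled ${\bf 0}$ and ${\bf 1}$; every non-sink node has two children and is either a conjunction node or a decision node labelled by a variable, whose two outgoing edges are labelled $0$ and $1$. For a node $u$, $B_u$ is the sub-DAG of nodes reachable from $u$, and $\mathsf{var}(B_u)$ is the set of variables labelling decision nodes of $B_u$. It is required that (decomposability) for every conjunction node with children $u_0,u_1$, $\mathsf{var}(B_{u_0})\cap\mathsf{var}(B_{u_1})=\emptyset$, and (read-once) no directed path contains two decision nodes labelled by the same variable. The size $|B|$ is the number of nodes. The set $\mathcal{A}(B)$ of accepted assignments is defined recursively: for a single ${\bf 1}$-sink it is $\{\emptyset\}$, for a single ${\bf 0}$-sink it is $\emptyset$; if the source is a decision node labelled $x$ with $0$-child $u_0$ and $1$-child $u_1$,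 then $\mathcal{A}(B)=\mathcal{A}(B_{u_0})\times\{(x,0)\}\cup\mathcal{A}(B_{u_1})\times\{(x,1)\}$; if the source is a conjunction node with children $u_0,u_1$, then $\mathcal{A}(B)=\mathcal{A}(B_{u_0})\times\mathcal{A}(B_{u_1})$. The function $f(B)$ is the Boolean function on $\mathsf{var}(B)$ whose satisfying assignments are those extending some element of $\mathcal{A}(B)$; $B$ represents a Boolean function $f$ if $f(B)=f$. A CNF $\varphi$ is regarded as a Boolean function on the set $\mathsf{var}(\varphi)$ of variables occurring in it. An FBDD is a $\wedge_d$-FBDD with no conjunction nodes. A $\wedge_d$-OBDD is a $\wedge_d$-FBDD $B$ for which there is a linear order $\pi$ of a superset of $\mathsf{var}(B)$ such that along every directed path the labels of decision nodes appear in increasing $\pi$-order. *)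

theory Defs
  imports Main "HOL-Computational_Algebra.Polynomial" Complex_Main
begin

section \<open>Assignments, Boolean functions and CNFs\<close>

type_synonym 'v assignment = "'v \<rightharpoonup> bool"

text \<open>Only used for sets of assignments over disjoint sets of variables, where \<open>++\<close> is the
  union of the graphs.\<close>

definition aprod :: "'v assignment set \<Rightarrow> 'v assignment set \<Rightarrow> 'v assignment set" where
  "aprod H1 H2 = {a ++ b | a b. a \<in> H1 \<and> b \<in> H2}"

text \<open>A Boolean function is given by its set of variables together with its satisfying
  assignments, each of which has exactly that set as its domain.\<close>

type_synonym 'v bool_fun = "'v set \<times> 'v assignment set"

text \<open>The literal \<open>(x, b)\<close> is satisfied by \<open>a\<close> iff \<open>a x = Some b\<close>;
  so \<open>(x, True)\<close> is the positive and \<open>(x, False)\<close> the negative literal of \<open>x\<close>.\<close>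

type_synonym 'v cnf = "('v \<times> bool) set set"

definition is_cnf :: "'v cnf \<Rightarrow> bool" where
  "is_cnf \<phi> \<longleftrightarrow> finite \<phi> \<and> (\<forall>C\<in>\<phi>. finite C)"

definition cnf_vars :: "'v cnf \<Rightarrow> 'v set" where
  "cnf_vars \<phi> = (\<Union>C\<in>\<phi>. fst ` C)"

definition cnf_fun :: "'v cnf \<Rightarrow> 'v bool_fun" where
  "cnf_fun \<phi> =
     (cnf_vars \<phi>, {a. dom a = cnf_vars \<phi> \<and> (\<forall>C\<in>\<phi>. \<exists>(x, b)\<in>C. a x = Some b)})"


section \<open>Decomposable branching programs\<close>

text \<open>\<open>Decision x u0 u1\<close> has \<open>0\<close>-child \<open>u0\<close> and \<open>1\<close>-child \<open>u1\<close>.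
  The two children of a node may coincide.\<close>

datatype ('n, 'v) node_label =
    Sink bool
  | Conj 'n 'n
  | Decision 'v 'n 'n

primrec children :: "('n, 'v) node_label \<Rightarrow> 'n set" where
  "children (Sink b) = {}"
| "children (Conj u0 u1) = {u0, u1}"
| "children (Decision x u0 u1) = {u0, u1}"

primrec decision_var :: "('n, 'v) node_label \<Rightarrow> 'v option" where
  "decision_var (Sink b) = None"
| "decision_var (Conj u0 u1) = None"
| "decision_var (Decision x u0 u1) = Some x"

record ('n, 'v) bdd =
  nodes :: "'n set"
  source :: 'n
  label :: "'n \<Rightarrow> ('n, 'v) node_label"

definition edges :: "('n, 'v) bdd \<Rightarrow> ('n \<times> 'n) set" where
  "edges B = {(u, v). u \<in> nodes B \<and> v \<in> children (label B u)}"

definition sub_bdd :: "('n, 'v) bdd \<Rightarrow> 'n \<Rightarrow> ('n, 'v) bdd" where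
  "sub_bdd B u = B\<lparr>nodes := {v. (u, v) \<in> (edges B)\<^sup>*}, source := u\<rparr>"

definition bdd_vars :: "('n, 'v) bdd \<Rightarrow> 'v set" where
  "bdd_vars B = {x. \<exists>u\<in>nodes B. decision_var (label B u) = Some x}"

definition bdd_size :: "('n, 'v) bdd \<Rightarrow> nat" where
  "bdd_size B = card (nodes B)"

definition dpath :: "('n, 'v) bdd \<Rightarrow> 'n list \<Rightarrow> bool" where
  "dpath B us \<longleftrightarrow>
     us \<noteq> [] \<and> set us \<subseteq> nodes B \<and> successively (\<lambda>u v. (u, v) \<in> edges B) us"

definition path_vars :: "('n, 'v) bdd \<Rightarrow> 'n list \<Rightarrow> 'v list" where
  "path_vars B us = List.map_filter (\<lambda>u. decision_var (label B u)) us"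

definition bdd_dag :: "('n, 'v) bdd \<Rightarrow> bool" where
  "bdd_dag B \<longleftrightarrow>
     finite (nodes B) \<and>
     edges B \<subseteq> nodes B \<times> nodes B \<and>
     acyclic (edges B) \<and>
     source B \<in> nodes B \<and>
     (\<forall>u\<in>nodes B. (\<nexists>w. (w, u) \<in> edges B) \<longleftrightarrow> u = source B) \<and>
     (\<forall>b. \<exists>!u. u \<in> nodes B \<and> label B u = Sink b)"

definition decomposable :: "('n, 'v) bdd \<Rightarrow> bool" where
  "decomposable B \<longleftrightarrow>
     (\<forall>u\<in>nodes B. \<forall>u0 u1. label B u = Conj u0 u1 \<longrightarrow>
        bdd_vars (sub_bdd B u0) \<inter> bdd_vars (sub_bdd B u1) = {})"

definition read_once :: "('n, 'v) bdd \<Rightarrow> bool" where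
  "read_once B \<longleftrightarrow> (\<forall>us. dpath B us \<longrightarrow> distinct (path_vars B us))"

definition and_fbdd :: "('n, 'v) bdd \<Rightarrow> bool" where
  "and_fbdd B \<longleftrightarrow> bdd_dag B \<and> decomposable B \<and> read_once B"

definition fbdd :: "('n, 'v) bdd \<Rightarrow> bool" where
  "fbdd B \<longleftrightarrow> and_fbdd B \<and> (\<forall>u\<in>nodes B. \<forall>u0 u1. label B u \<noteq> Conj u0 u1)"

definition and_obdd :: "('n, 'v) bdd \<Rightarrow> bool" where
  "and_obdd B \<longleftrightarrow> and_fbdd B \<and>
     (\<exists>V \<pi>. bdd_vars B \<subseteq> V \<and> linear_order_on V \<pi> \<and>
        (\<forall>us. dpath B us \<longrightarrow>
           sorted_wrt (\<lambda>x y. (x, y) \<in> \<pi> \<and> x \<noteq> y) (path_vars B us)))"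


section \<open>Accepted assignments and represented functions\<close>

text \<open>The recursion over the graph is not a recursion over a datatype, so the accepted
  assignments are defined inductively. The lemmas \<open>accepted_*\<close> below give the
  recursive equations, which determine the sets uniquely since the graph is finite and acyclic.\<close>

inductive accepts :: "('n \<Rightarrow> ('n, 'v) node_label) \<Rightarrow> 'n \<Rightarrow> 'v assignment \<Rightarrow> bool"
  for l where
  one: "l u = Sink True \<Longrightarrow> accepts l u Map.empty"
| dec0: "l u = Decision x u0 u1 \<Longrightarrow> accepts l u0 a \<Longrightarrow> accepts l u (a ++ [x \<mapsto> False])"
| dec1: "l u = Decision x u0 u1 \<Longrightarrow> accepts l u1 a \<Longrightarrow> accepts l u (a ++ [x \<mapsto> True])"
| conj: "l u = Conj u0 u1 \<Longrightarrow> accepts l u0 a \<Longrightarrow> accepts l u1 b \<Longrightarrow> accepts l u (a ++ b)"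

definition accepted :: "('n, 'v) bdd \<Rightarrow> 'v assignment set" where
  "accepted B = {a. accepts (label B) (source B) a}"

lemma accepted_Sink_True:
  "label B (source B) = Sink True \<Longrightarrow> accepted B = {Map.empty}"
  unfolding accepted_def
  by (auto intro: accepts.one elim: accepts.cases)

lemma accepted_Sink_False:
  "label B (source B) = Sink False \<Longrightarrow> accepted B = {}"
  unfolding accepted_def
  by (auto elim: accepts.cases)

lemma accepted_Decision:
  assumes "label B (source B) = Decision x u0 u1"
  shows "accepted B = aprod (accepted (sub_bdd B u0)) {[x \<mapsto> False]}
                    \<union> aprod (accepted (sub_bdd B u1)) {[x \<mapsto> True]}" (is "?L = ?R")
proof (rule set_eqI)
  fix a
  have "a \<in> ?L \<longleftrightarrow> accepts (label B) (source B) a"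
    by (simp add: accepted_def)
  also have "\<dots> \<longleftrightarrow> a \<in> ?R"
    by (subst accepts.simps) (auto simp: assms accepted_def aprod_def sub_bdd_def)
  finally show "a \<in> ?L \<longleftrightarrow> a \<in> ?R" .
qed

lemma accepted_Conj:
  assumes "label B (source B) = Conj u0 u1"
  shows "accepted B = aprod (accepted (sub_bdd B u0)) (accepted (sub_bdd B u1))" (is "?L = ?R")
proof (rule set_eqI)
  fix a
  have "a \<in> ?L \<longleftrightarrow> accepts (label B) (source B) a"
    by (simp add: accepted_def)
  also have "\<dots> \<longleftrightarrow> a \<in> ?R"
    by (subst accepts.simps) (auto simp: assms accepted_def aprod_def sub_bdd_def)
  finally show "a \<in> ?L \<longleftrightarrow> a \<in> ?R" .
qed

definition bdd_fun :: "('n, 'v) bdd \<Rightarrow> 'v bool_fun" where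
  "bdd_fun B =
     (bdd_vars B, {a. dom a = bdd_vars B \<and> (\<exists>b\<in>accepted B. b \<subseteq>\<^sub>m a)})"

definition represents :: "('n, 'v) bdd \<Rightarrow> 'v bool_fun \<Rightarrow> bool" where
  "represents B f \<longleftrightarrow> bdd_fun B = f"

end

theory Submission
  imports Defs "HOL-Library.Countable"
begin

text \<open>The separating function reads selectors \<open>t\<close>, lets \<open>s\<close> be the first index with \<open>t\<^sub>s = 1\<close>, and
  returns the parity of the products \<open>x\<^sub>i y\<^sub>j\<close> over all pairs with \<open>i + j = s\<close> modulo \<open>n\<close>. Since the
  size of a CNF is unrestricted, its canonical CNF will do. An FBDD reads \<open>s\<close> first and then each
  pair consecutively. A fixed order has a prefix \<open>P\<close> containing exactly half of the variables
  \<open>x, y\<close>, and averaging over the shifts gives an \<open>s\<close> for which at least \<open>n/4\<close> of the pairs are separated by \<open>P\<close>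
  in the same direction. After fixing the selectors to \<open>s\<close>, the assignments to \<open>P\<close> yield
  exponentially many distinct subfunctions, each linear in some unread variable. Linear functions
  are not conjunctions in a nontrivial way, so conjunction nodes do not help and each subfunction
  needs its own decision node.\<close>

section \<open>Total assignments\<close>

text \<open>Total assignments allow restrictions to be written with \<open>override_on\<close>, with
  no bookkeeping of domains; \<open>models_cong\<close> shows that only the variables below
  \<open>u\<close> influence the value.\<close>

definition models :: "('n, 'v) bdd \<Rightarrow> 'n \<Rightarrow> ('v \<Rightarrow> bool) \<Rightarrow> bool" where
  "models B u \<sigma> \<longleftrightarrow> (\<exists>b. accepts (label B) u b \<and> b \<subseteq>\<^sub>m Some \<circ> \<sigma>)"

abbreviation vars_below :: "('n, 'v) bdd \<Rightarrow> 'n \<Rightarrow> 'v set" where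
  "vars_below B u \<equiv> bdd_vars (sub_bdd B u)"

lemma vars_below_iff:
  "x \<in> vars_below B u \<longleftrightarrow> (\<exists>v. (u, v) \<in> (edges B)\<^sup>* \<and> decision_var (label B v) = Some x)"
  by (auto simp: bdd_vars_def sub_bdd_def)

section \<open>Reachability and paths\<close>

lemma edgesI: "u \<in> nodes B \<Longrightarrow> v \<in> children (label B u) \<Longrightarrow> (u, v) \<in> edges B"
  by (simp add: edges_def)

lemma vars_below_edge: "(u, v) \<in> edges B \<Longrightarrow> vars_below B v \<subseteq> vars_below B u"
  unfolding vars_below_iff subset_iff by (blast intro: converse_rtrancl_into_rtrancl)

lemma bdd_dag_child: "bdd_dag B \<Longrightarrow> u \<in> nodes B \<Longrightarrow> v \<in> children (label B u) \<Longrightarrow> v \<in> nodes B"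
  by (auto simp: bdd_dag_def dest!: edgesI)

text \<open>Walking backwards from \<open>u\<close> ends after finitely many steps in a finite
  acyclic graph, and only the source lacks a predecessor.\<close>

lemma bdd_dag_reach_source:
  assumes "bdd_dag B" "u \<in> nodes B"
  shows "(source B, u) \<in> (edges B)\<^sup>*"
proof -
  have "wf (edges B)"
    using assms(1) finite_acyclic_wf[of "edges B"] finite_subset
    unfolding bdd_dag_def by blast
  then show ?thesis using assms(2)
  proof (induction u rule: wf_induct_rule)
    case (less u)
    show ?case
    proof (cases "u = source B")
      case False
      then obtain w where w: "(w, u) \<in> edges B"
        using assms(1) less.prems unfolding bdd_dag_def by blast
      then have "w \<in> nodes B" by (simp add: edges_def)
      with less.IH[OF w] w show ?thesis by (meson rtrancl.rtrancl_into_rtrancl)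
    qed simp
  qed
qed

lemma vars_below_source: "bdd_dag B \<Longrightarrow> vars_below B (source B) = bdd_vars B"
proof -
  assume B: "bdd_dag B"
  have "v \<in> nodes B" if "(source B, v) \<in> (edges B)\<^sup>*" for v
    using that B by (induction rule: rtrancl_induct) (auto simp: bdd_dag_def)
  then show ?thesis
    unfolding set_eq_iff vars_below_iff
    by (auto simp: bdd_vars_def intro: bdd_dag_reach_source[OF B])
qed

text \<open>Only an inclusion can be expected, because an accepted assignment need not test every
  variable below \<open>u\<close>.\<close>

lemma accepts_dom:
  assumes "accepts (label B) u b" "bdd_dag B" "u \<in> nodes B"
  shows "dom b \<subseteq> vars_below B u"
  using assms
proof (induction rule: accepts.induct)
  case (dec0 u x u0 u1 a)
  then have "(u, u0) \<in> edges B" "u0 \<in> nodes B" "x \<in> vars_below B u"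
    by (auto simp: vars_below_iff intro: edgesI bdd_dag_child)
  with dec0 show ?case using vars_below_edge by (fastforce simp: dom_def)
next
  case (dec1 u x u0 u1 a)
  then have "(u, u1) \<in> edges B" "u1 \<in> nodes B" "x \<in> vars_below B u"
    by (auto simp: vars_below_iff intro: edgesI bdd_dag_child)
  with dec1 show ?case using vars_below_edge by (fastforce simp: dom_def)
next
  case (conj u u0 u1 a b)
  then have "(u, u0) \<in> edges B" "u0 \<in> nodes B" "(u, u1) \<in> edges B" "u1 \<in> nodes B"
    by (auto intro: edgesI bdd_dag_child)
  with conj show ?case using vars_below_edge by (metis (no_types, lifting) dom_map_add sup.boundedI sup.coboundedI1 sup.coboundedI2 subset_trans)
qed simp

lemma path_vars_append_last:
  "us \<noteq> [] \<Longrightarrow> decision_var (label B (last us)) = Some x \<Longrightarrow> x \<in> set (path_vars B us)"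
  by (force simp: path_vars_def map_filter_def)

lemma rtrancl_edges_dpath:
  assumes "bdd_dag B" "(u, v) \<in> (edges B)\<^sup>*" "u \<in> nodes B"
  shows "\<exists>us. dpath B us \<and> hd us = u \<and> last us = v"
  using assms(2,3)
proof (induction rule: converse_rtrancl_induct)
  case base
  then have "dpath B [v]" by (simp add: dpath_def)
  then show ?case by force
next
  case (step u w)
  then have "w \<in> nodes B" using assms(1) by (auto simp: bdd_dag_def)
  then obtain us where us: "dpath B us" "hd us = w" "last us = v"
    using step.IH by blast
  then have "dpath B (u # us)" using step.hyps(1) step.prems
    by (cases us) (auto simp: dpath_def)
  moreover have "last (u # us) = v" using us by (simp add: dpath_def)
  ultimately show ?case by (metis list.sel(1))
qed

text \<open>Read-once and ordering are both conditions on the labels along paths. A path that starts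
  at \<open>u\<close> and meets \<open>y\<close> brings either condition to bear on \<open>x\<close>
  and \<open>y\<close>.\<close>

lemma decision_dpath:
  assumes "bdd_dag B" "u \<in> nodes B" "label B u = Decision x u0 u1"
    and "w \<in> {u0, u1}" "y \<in> vars_below B w"
  shows "\<exists>us. dpath B (u # us) \<and> path_vars B (u # us) = x # path_vars B us \<and>
     y \<in> set (path_vars B us)"
proof -
  obtain v where v: "(w, v) \<in> (edges B)\<^sup>*" "decision_var (label B v) = Some y"
    using assms(5) by (auto simp: vars_below_iff)
  have e: "(u, w) \<in> edges B" "w \<in> nodes B"
    using assms by (auto intro: edgesI bdd_dag_child)
  obtain us where us: "dpath B us" "hd us = w" "last us = v"
    using rtrancl_edges_dpath[OF assms(1) v(1) e(2)] by blast
  have "dpath B (u # us)"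
    using us e assms(2) by (cases us) (auto simp: dpath_def)
  moreover have "path_vars B (u # us) = x # path_vars B us"
    using assms(3) by (simp add: path_vars_def List.map_filter_simps)
  moreover have "y \<in> set (path_vars B us)"
    using us v by (intro path_vars_append_last) (auto simp: dpath_def)
  ultimately show ?thesis by blast
qed

lemma read_once_below:
  assumes "bdd_dag B" "read_once B" "u \<in> nodes B" "label B u = Decision x u0 u1" "w \<in> {u0, u1}"
  shows "x \<notin> vars_below B w"
proof
  assume "x \<in> vars_below B w"
  then obtain us where "dpath B (u # us)" "path_vars B (u # us) = x # path_vars B us"
     "x \<in> set (path_vars B us)"
    using decision_dpath[OF assms(1,3,4,5)] by blast
  with assms(2) show False unfolding read_once_def by fastforce
qed

section \<open>Semantics of the node types\<close>

lemma models_Sink: "label B u = Sink b \<Longrightarrow> models B u \<sigma> \<longleftrightarrow> b"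
  unfolding models_def by (cases b) (auto elim: accepts.cases intro: accepts.one)

lemma map_add_le_disjoint:
  "dom a \<inter> dom b = {} \<Longrightarrow> a ++ b \<subseteq>\<^sub>m c \<longleftrightarrow> a \<subseteq>\<^sub>m c \<and> b \<subseteq>\<^sub>m c"
  using map_add_comm[of a b] map_le_map_add[of a b] map_le_map_add[of b a]
  by (metis map_add_le_mapI map_le_trans)

text \<open>Decomposability gives the accepted parts disjoint domains, so in \<open>a ++ b\<close>
  neither overrides the other, and a total assignment extends the union exactly if it extends both
  parts.\<close>

lemma models_Conj:
  assumes B: "and_fbdd B" "u \<in> nodes B" "label B u = Conj u0 u1"
  shows "models B u \<sigma> \<longleftrightarrow> models B u0 \<sigma> \<and> models B u1 \<sigma>"
proof -
  have dag: "bdd_dag B" and disj: "vars_below B u0 \<inter> vars_below B u1 = {}"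
    using B by (auto simp: and_fbdd_def decomposable_def)
  have "u0 \<in> nodes B" "u1 \<in> nodes B"
    using B dag by (auto intro: bdd_dag_child)
  then have "a ++ b \<subseteq>\<^sub>m c \<longleftrightarrow> a \<subseteq>\<^sub>m c \<and> b \<subseteq>\<^sub>m c"
    if "accepts (label B) u0 a" "accepts (label B) u1 b" for a b c
    using accepts_dom[OF that(1) dag] accepts_dom[OF that(2) dag] disj
    by (intro map_add_le_disjoint) blast
  then have le: "accepts (label B) u0 a \<and> accepts (label B) u1 b \<and> a ++ b \<subseteq>\<^sub>m c \<longleftrightarrow>
      (accepts (label B) u0 a \<and> a \<subseteq>\<^sub>m c) \<and> (accepts (label B) u1 b \<and> b \<subseteq>\<^sub>m c)" for a b c
    by blast
  have acc: "accepts (label B) u c \<longleftrightarrow>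
      (\<exists>a b. c = a ++ b \<and> accepts (label B) u0 a \<and> accepts (label B) u1 b)" for c
    by (subst accepts.simps) (auto simp: B(3))
  have "models B u \<sigma> \<longleftrightarrow> (\<exists>a b. accepts (label B) u0 a \<and> accepts (label B) u1 b \<and> a ++ b \<subseteq>\<^sub>m Some \<circ> \<sigma>)"
    unfolding models_def acc by blast
  then show ?thesis unfolding models_def le by blast
qed

text \<open>By read-once, \<open>x\<close> is not assigned below its own decision node, so the pair
  added for \<open>x\<close> overrides nothing and merely selects the child.\<close>

lemma models_Decision:
  assumes B: "and_fbdd B" "u \<in> nodes B" "label B u = Decision x u0 u1"
  shows "models B u \<sigma> \<longleftrightarrow> models B (if \<sigma> x then u1 else u0) \<sigma>"
proof -
  have dag: "bdd_dag B" using B by (simp add: and_fbdd_def)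
  have w: "u0 \<in> nodes B" "u1 \<in> nodes B"
    using B dag by (auto intro: bdd_dag_child)
  have "x \<notin> vars_below B u0" "x \<notin> vars_below B u1"
    using read_once_below[OF dag _ B(2,3)] B(1) by (auto simp: and_fbdd_def)
  then have le: "a ++ [x \<mapsto> d] \<subseteq>\<^sub>m Some \<circ> \<sigma> \<longleftrightarrow> a \<subseteq>\<^sub>m Some \<circ> \<sigma> \<and> d = \<sigma> x"
    if "accepts (label B) u0 a \<or> accepts (label B) u1 a" for a d
  proof -
    have "x \<notin> dom a"
      using that accepts_dom[OF _ dag] w \<open>x \<notin> vars_below B u0\<close> \<open>x \<notin> vars_below B u1\<close> by blast
    then show ?thesis
      by (subst map_add_le_disjoint) (auto simp: map_le_def)
  qed
  have acc: "accepts (label B) u c \<longleftrightarrow>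
      (\<exists>a. c = a ++ [x \<mapsto> False] \<and> accepts (label B) u0 a) \<or>
      (\<exists>a. c = a ++ [x \<mapsto> True] \<and> accepts (label B) u1 a)" for c
    by (subst accepts.simps) (auto simp: B(3))
  have "models B u \<sigma> \<longleftrightarrow>
      (\<exists>a. accepts (label B) u0 a \<and> a ++ [x \<mapsto> False] \<subseteq>\<^sub>m Some \<circ> \<sigma>) \<or>
      (\<exists>a. accepts (label B) u1 a \<and> a ++ [x \<mapsto> True] \<subseteq>\<^sub>m Some \<circ> \<sigma>)"
    unfolding models_def acc by blast
  also have "\<dots> \<longleftrightarrow>
      (\<exists>a. accepts (label B) u0 a \<and> a \<subseteq>\<^sub>m Some \<circ> \<sigma> \<and> False = \<sigma> x) \<or>
      (\<exists>a. accepts (label B) u1 a \<and> a \<subseteq>\<^sub>m Some \<circ> \<sigma> \<and> True = \<sigma> x)"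
    using le by blast
  finally show ?thesis unfolding models_def by auto
qed

lemma models_cong:
  assumes "bdd_dag B" "u \<in> nodes B" "\<And>x. x \<in> vars_below B u \<Longrightarrow> \<sigma> x = \<tau> x"
  shows "models B u \<sigma> \<longleftrightarrow> models B u \<tau>"
proof -
  have "b \<subseteq>\<^sub>m Some \<circ> \<sigma> \<longleftrightarrow> b \<subseteq>\<^sub>m Some \<circ> \<tau>" if "accepts (label B) u b" for b
  proof -
    have "\<sigma> x = \<tau> x" if "x \<in> dom b" for x
      using that accepts_dom[OF \<open>accepts (label B) u b\<close> assms(1,2)] assms(3) by blast
    then show ?thesis by (simp add: map_le_def)
  qed
  then show ?thesis unfolding models_def by blast
qed

section \<open>Representation of a CNF in terms of total assignments\<close>

definition sat_cnf :: "('v \<Rightarrow> bool) \<Rightarrow> 'v cnf \<Rightarrow> bool" where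
  "sat_cnf \<sigma> \<phi> \<longleftrightarrow> (\<forall>C\<in>\<phi>. \<exists>(x, b)\<in>C. \<sigma> x = b)"

lemma represents_cnf_iff:
  assumes "bdd_dag B"
  shows "represents B (cnf_fun \<phi>) \<longleftrightarrow>
    bdd_vars B = cnf_vars \<phi> \<and> (\<forall>\<sigma>. models B (source B) \<sigma> \<longleftrightarrow> sat_cnf \<sigma> \<phi>)"
proof -
  have src: "source B \<in> nodes B" using assms by (simp add: bdd_dag_def)
  let ?r = "\<lambda>\<sigma>. (Some \<circ> \<sigma>) |` cnf_vars \<phi>"
  have acc: "(\<exists>b\<in>accepted B. b \<subseteq>\<^sub>m ?r \<sigma>) \<longleftrightarrow> models B (source B) \<sigma>"
    if "bdd_vars B = cnf_vars \<phi>" for \<sigma>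
  proof -
    have "b \<subseteq>\<^sub>m ?r \<sigma> \<longleftrightarrow> b \<subseteq>\<^sub>m Some \<circ> \<sigma>" if "accepts (label B) (source B) b" for b
    proof -
      have "dom b \<subseteq> cnf_vars \<phi>"
        using accepts_dom[OF that assms src] vars_below_source[OF assms] \<open>bdd_vars B = cnf_vars \<phi>\<close>
        by simp
      then have "?r \<sigma> x = (Some \<circ> \<sigma>) x" if "x \<in> dom b" for x
        using that by (meson restrict_in subsetD)
      then show ?thesis by (simp only: map_le_def cong: ball_cong)
    qed
    then show ?thesis unfolding models_def accepted_def by blast
  qed
  have cl: "(\<forall>C\<in>\<phi>. \<exists>(x, b)\<in>C. ?r \<sigma> x = Some b) \<longleftrightarrow> sat_cnf \<sigma> \<phi>" for \<sigma>
  proof -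
    have "?r \<sigma> x = Some b \<longleftrightarrow> \<sigma> x = b" if "C \<in> \<phi>" "(x, b) \<in> C" for x b C
      using that by (force simp: cnf_vars_def restrict_map_def)
    then have "(\<exists>(x, b)\<in>C. ?r \<sigma> x = Some b) \<longleftrightarrow> (\<exists>(x, b)\<in>C. \<sigma> x = b)" if "C \<in> \<phi>" for C
      using that by (intro bex_cong) auto
    then show ?thesis unfolding sat_cnf_def by simp
  qed
  have dom: "dom (?r \<sigma>) = cnf_vars \<phi>" for \<sigma> by (auto simp: dom_def restrict_map_def)
  have total: "\<exists>\<sigma>. a = ?r \<sigma>" if "dom a = cnf_vars \<phi>" for a
  proof
    show "a = ?r (\<lambda>x. the (a x))"
    proof
      fix x show "a x = ?r (\<lambda>x. the (a x)) x"
        unfolding that[symmetric] by (cases "a x") (simp_all add: restrict_map_def domIff)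
    qed
  qed
  \<comment> \<open>Every assignment with domain \<open>cnf_vars \<phi>\<close> is the restriction
    of a total one, so equality of two sets of them reduces to equivalence of their predicates on
    the restrictions \<open>?r \<sigma>\<close>.\<close>
  have "{a. dom a = cnf_vars \<phi> \<and> P a} = {a. dom a = cnf_vars \<phi> \<and> Q a} \<longleftrightarrow> (\<forall>\<sigma>. P (?r \<sigma>) \<longleftrightarrow> Q (?r \<sigma>))"
    for P Q :: "'b assignment \<Rightarrow> bool"
  proof
    assume "{a. dom a = cnf_vars \<phi> \<and> P a} = {a. dom a = cnf_vars \<phi> \<and> Q a}"
    then have eq: "dom a = cnf_vars \<phi> \<Longrightarrow> P a \<longleftrightarrow> Q a" for a by blast
    show "\<forall>\<sigma>. P (?r \<sigma>) \<longleftrightarrow> Q (?r \<sigma>)" by (intro allI eq dom)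
  next
    assume "\<forall>\<sigma>. P (?r \<sigma>) \<longleftrightarrow> Q (?r \<sigma>)"
    then have "P a \<longleftrightarrow> Q a" if "dom a = cnf_vars \<phi>" for a
      using total[OF that] by (elim exE) simp
    then show "{a. dom a = cnf_vars \<phi> \<and> P a} = {a. dom a = cnf_vars \<phi> \<and> Q a}" by blast
  qed
  note ext = this
  show ?thesis
    unfolding represents_def bdd_fun_def cnf_fun_def prod.inject
    by (intro conj_cong refl) (simp only: ext acc cl)
qed

section \<open>Restrictions of decomposable diagrams\<close>

text \<open>A conjunction of two nonconstant functions on disjoint variables is never linear in a
  variable, so along the path chosen here all conjunction nodes are trivial.\<close>

lemma linear_restriction_node:
  assumes B: "and_fbdd B" and u: "u \<in> nodes B" and y: "y \<notin> Q"
    and lin: "\<And>\<tau>. models B u (override_on (\<tau>(y := \<not> \<tau> y)) \<sigma> Q) \<longleftrightarrow> \<not> models B u (override_on \<tau> \<sigma> Q)"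
  shows "\<exists>v\<in>nodes B. (\<exists>x u0 u1. label B v = Decision x u0 u1 \<and> x \<notin> Q) \<and>
     (\<forall>\<tau>. models B u (override_on \<tau> \<sigma> Q) \<longleftrightarrow> models B v (override_on \<tau> \<sigma> Q))"
proof -
  have dag: "bdd_dag B" using B by (simp add: and_fbdd_def)
  \<comment> \<open>The induction assumes the claim for the children of a node, so it runs along the
    converse of the edges.\<close>
  have "wf ((edges B)\<inverse>)"
    using dag finite_acyclic_wf_converse[of "edges B"] finite_subset
    unfolding bdd_dag_def by blast
  then show ?thesis using u lin
  proof (induction u rule: wf_induct_rule)
    case (less u)
    have child: "w \<in> nodes B \<and> (w, u) \<in> (edges B)\<inverse>" if "w \<in> children (label B u)" for w
      using that less.prems(1) dag by (auto intro: edgesI bdd_dag_child)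
    have descend: ?case if "w \<in> children (label B u)"
      "\<And>\<tau>. models B u (override_on \<tau> \<sigma> Q) \<longleftrightarrow> models B w (override_on \<tau> \<sigma> Q)" for w
      using less.IH[of w] child[OF that(1)] less.prems(2) unfolding that(2) by blast
    show ?case
    proof (cases "label B u")
      case (Sink b)
      \<comment> \<open>A sink is constant, whereas flipping \<open>y\<close> has to change the
        value.\<close>
      with less.prems(2)[of undefined] show ?thesis by (simp add: models_Sink)
    next
      case (Decision x u0 u1)
      show ?thesis
      proof (cases "x \<in> Q")
        case True
        have "models B u (override_on \<tau> \<sigma> Q) \<longleftrightarrow>
            models B (if \<sigma> x then u1 else u0) (override_on \<tau> \<sigma> Q)" for \<tau>
          using models_Decision[OF B less.prems(1) Decision] True by simp
        then show ?thesis
          by (intro descend[of "if \<sigma> x then u1 else u0"]) (simp_all add: Decision)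
      next
        case False
        with Decision less.prems(1) show ?thesis by blast
      qed
    next
      case (Conj u0 u1)
      note mC = models_Conj[OF B less.prems(1) Conj]
      have n: "u0 \<in> nodes B" "u1 \<in> nodes B" using child Conj by auto
      \<comment> \<open>A child without \<open>y\<close> must be constantly true under the
        restriction: if it failed at \<open>\<tau>\<close>, it would still fail after flipping
        \<open>y\<close>, and the conjunction would be false both times. By decomposability at least
        one child lacks \<open>y\<close>.\<close>
      have triv: "models B w (override_on \<tau> \<sigma> Q)" if "w \<in> {u0, u1}" "y \<notin> vars_below B w" for w \<tau>
      proof (rule ccontr)
        assume "\<not> models B w (override_on \<tau> \<sigma> Q)"
        moreover have "models B w (override_on \<tau> \<sigma> Q) \<longleftrightarrow>
            models B w (override_on (\<tau>(y := \<not> \<tau> y)) \<sigma> Q)"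
          using that n by (intro models_cong[OF dag]) (auto simp: override_on_def)
        ultimately show False using less.prems(2)[of \<tau>] that(1) by (auto simp only: mC)
      qed
      have "vars_below B u0 \<inter> vars_below B u1 = {}"
        using B less.prems(1) Conj by (auto simp: and_fbdd_def decomposable_def)
      then consider "y \<notin> vars_below B u0" | "y \<notin> vars_below B u1" by blast
      then show ?thesis
      proof cases
        case 1
        then have "models B u (override_on \<tau> \<sigma> Q) \<longleftrightarrow> models B u1 (override_on \<tau> \<sigma> Q)" for \<tau>
          by (simp add: mC triv)
        then show ?thesis by (intro descend[of u1]) (simp_all add: Conj)
      next
        case 2
        then have "models B u (override_on \<tau> \<sigma> Q) \<longleftrightarrow> models B u0 (override_on \<tau> \<sigma> Q)" for \<tau>
          by (simp add: mC triv)
        then show ?thesis by (intro descend[of u0]) (simp_all add: Conj)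
      qed
    qed
  qed
qed

text \<open>Each restriction is computed by a decision node whose variable is outside
  \<open>P \<union> Z\<close>. No variable of \<open>P\<close> occurs at or below that node, and on
  \<open>Z\<close> all \<open>\<sigma> j\<close> coincide, so the value of the node no longer
  depends on \<open>j\<close>. Distinct restrictions therefore need distinct nodes.\<close>

lemma card_linear_restrictions_le:
  fixes \<sigma> :: "'j \<Rightarrow> 'v \<Rightarrow> bool"
  assumes B: "and_fbdd B"
    and P: "\<And>u x u0 u1 y w. u \<in> nodes B \<Longrightarrow> label B u = Decision x u0 u1 \<Longrightarrow> x \<notin> P \<Longrightarrow>
        w \<in> {u0, u1} \<Longrightarrow> y \<in> vars_below B w \<Longrightarrow> y \<notin> P"
    and Z: "\<And>j z. j \<in> J \<Longrightarrow> z \<in> Z \<Longrightarrow> \<sigma> j z = \<rho> z"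
    and lin: "\<And>j. j \<in> J \<Longrightarrow> \<exists>y. y \<notin> P \<union> Z \<and> (\<forall>\<tau>.
        models B (source B) (override_on (\<tau>(y := \<not> \<tau> y)) (\<sigma> j) (P \<union> Z)) \<longleftrightarrow>
        \<not> models B (source B) (override_on \<tau> (\<sigma> j) (P \<union> Z)))"
    and dist: "\<And>j k. j \<in> J \<Longrightarrow> k \<in> J \<Longrightarrow> j \<noteq> k \<Longrightarrow> \<exists>\<tau>.
        models B (source B) (override_on \<tau> (\<sigma> j) (P \<union> Z)) \<noteq>
        models B (source B) (override_on \<tau> (\<sigma> k) (P \<union> Z))"
  shows "card J \<le> bdd_size B"
proof -
  have dag: "bdd_dag B" using B by (simp add: and_fbdd_def)
  have src: "source B \<in> nodes B" using dag by (simp add: bdd_dag_def)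
  have "\<forall>j\<in>J. \<exists>v\<in>nodes B. (\<exists>x u0 u1. label B v = Decision x u0 u1 \<and> x \<notin> P \<union> Z) \<and>
     (\<forall>\<tau>. models B (source B) (override_on \<tau> (\<sigma> j) (P \<union> Z)) \<longleftrightarrow>
       models B v (override_on \<tau> (\<sigma> j) (P \<union> Z)))"
  proof
    fix j assume "j \<in> J"
    then obtain y where "y \<notin> P \<union> Z" and "\<And>\<tau>.
        models B (source B) (override_on (\<tau>(y := \<not> \<tau> y)) (\<sigma> j) (P \<union> Z)) \<longleftrightarrow>
        \<not> models B (source B) (override_on \<tau> (\<sigma> j) (P \<union> Z))"
      using lin by meson
    then show "\<exists>v\<in>nodes B. (\<exists>x u0 u1. label B v = Decision x u0 u1 \<and> x \<notin> P \<union> Z) \<and>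
     (\<forall>\<tau>. models B (source B) (override_on \<tau> (\<sigma> j) (P \<union> Z)) \<longleftrightarrow>
       models B v (override_on \<tau> (\<sigma> j) (P \<union> Z)))"
      by (rule linear_restriction_node[OF B src])
  qed
  then obtain v where v: "\<And>j. j \<in> J \<Longrightarrow> v j \<in> nodes B"
    "\<And>j. j \<in> J \<Longrightarrow> \<exists>x u0 u1. label B (v j) = Decision x u0 u1 \<and> x \<notin> P \<union> Z"
    "\<And>j \<tau>. j \<in> J \<Longrightarrow> models B (source B) (override_on \<tau> (\<sigma> j) (P \<union> Z)) \<longleftrightarrow>
       models B (v j) (override_on \<tau> (\<sigma> j) (P \<union> Z))"
    by metis
  have "inj_on v J"
  proof (rule inj_onI, rule ccontr)
    fix j k assume jk: "j \<in> J" "k \<in> J" "v j = v k" "j \<noteq> k"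
    obtain x u0 u1 where l: "label B (v j) = Decision x u0 u1" "x \<notin> P \<union> Z"
      using v(2)[OF jk(1)] by blast
    have "z \<notin> P" if z: "z \<in> vars_below B (v j)" for z
    proof -
      obtain w where w: "(v j, w) \<in> (edges B)\<^sup>*" "decision_var (label B w) = Some z"
        using z by (auto simp: vars_below_iff)
      from w(1) show ?thesis
      proof (cases rule: converse_rtranclE)
        case base
        with w l show ?thesis by simp
      next
        case (step c)
        then have "c \<in> {u0, u1}" "z \<in> vars_below B c"
          using l w by (auto simp: edges_def vars_below_iff)
        then show ?thesis using P[OF v(1)[OF jk(1)] l(1)] l(2) by blast
      qed
    qed
    then have "models B (v j) (override_on \<tau> (\<sigma> j) (P \<union> Z)) \<longleftrightarrow>
        models B (v j) (override_on \<tau> (\<sigma> k) (P \<union> Z))" for \<tau>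
      using jk Z v(1) by (intro models_cong[OF dag]) (auto simp: override_on_def)
    then show False using dist[OF jk(1,2,4)] v(3) jk by metis
  qed
  then show ?thesis
    unfolding bdd_size_def using v(1) dag
    by (intro card_inj_on_le[of v]) (auto simp: bdd_dag_def)
qed

section \<open>Constructing free diagrams\<close>

text \<open>The diagram consists of the nodes reachable from \<open>r\<close>, inside a finite
  closed set \<open>S\<close>. \<open>W u\<close> bounds the variables that may still be read from
  \<open>u\<close>; its strict decrease along edges yields both acyclicity and read-once.
  \<open>ev u\<close> is the function intended at \<open>u\<close>, verified by its local
  recursion.\<close>

lemma fbdd_of_labelling:
  fixes lab :: "'n \<Rightarrow> ('n, 'v) node_label" and W :: "'n \<Rightarrow> 'v set"
    and ev :: "'n \<Rightarrow> ('v \<Rightarrow> bool) \<Rightarrow> bool" and r :: 'n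
  defines "R \<equiv> {v. (r, v) \<in> {(u, v). v \<in> children (lab u)}\<^sup>*}"
  assumes S: "finite S" "r \<in> S" "\<And>u. u \<in> S \<Longrightarrow> children (lab u) \<subseteq> S"
    and noconj: "\<And>u u0 u1. u \<in> S \<Longrightarrow> lab u \<noteq> Conj u0 u1"
    and W: "\<And>u x u0 u1 w. u \<in> S \<Longrightarrow> lab u = Decision x u0 u1 \<Longrightarrow> w \<in> {u0, u1} \<Longrightarrow>
      x \<in> W u \<and> W w \<subseteq> W u - {x}"
    and sink_unique: "\<And>u v b. u \<in> S \<Longrightarrow> v \<in> S \<Longrightarrow> lab u = Sink b \<Longrightarrow> lab v = Sink b \<Longrightarrow> u = v"
    and sink_exists: "\<And>b. \<exists>u\<in>R. lab u = Sink b"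
    and ev_Sink: "\<And>u b \<sigma>. u \<in> S \<Longrightarrow> lab u = Sink b \<Longrightarrow> ev u \<sigma> \<longleftrightarrow> b"
    and ev_Decision: "\<And>u x u0 u1 \<sigma>. u \<in> S \<Longrightarrow> lab u = Decision x u0 u1 \<Longrightarrow>
      ev u \<sigma> \<longleftrightarrow> ev (if \<sigma> x then u1 else u0) \<sigma>"
  shows "\<exists>B :: ('n, 'v) bdd. fbdd B \<and> bdd_size B \<le> card S \<and>
    bdd_vars B = {x. \<exists>u\<in>R. decision_var (lab u) = Some x} \<and>
    (\<forall>\<sigma>. models B (source B) \<sigma> \<longleftrightarrow> ev r \<sigma>)"
proof -
  define B :: "('n, 'v) bdd" where "B = \<lparr>nodes = R, source = r, label = lab\<rparr>"
  have [simp]: "nodes B = R" "source B = r" "label B = lab" by (simp_all add: B_def)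
  have "v \<in> S" if "(r, v) \<in> {(u, v). v \<in> children (lab u)}\<^sup>*" for v
    using that by (induction rule: rtrancl_induct) (use S in auto)
  then have RS: "R \<subseteq> S" by (auto simp: R_def)
  have edge: "u \<in> R \<and> v \<in> R \<and> v \<in> children (lab u)" if "(u, v) \<in> edges B" for u v
    using that by (auto simp: edges_def R_def intro: rtrancl_into_rtrancl)
  have W_edge: "\<exists>x. decision_var (lab u) = Some x \<and> x \<in> W u \<and> W v \<subseteq> W u - {x}"
    if e: "(u, v) \<in> edges B" for u v
  proof -
    have u: "u \<in> S" "v \<in> children (lab u)" using edge[OF e] RS by auto
    show ?thesis
    proof (cases "lab u")
      case (Decision x u0 u1)
      then show ?thesis using W[OF u(1) Decision, of v] u(2) by simp
    qed (use u noconj[OF u(1)] in auto)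
  qed
  have "W v \<subset> W u" if "(u, v) \<in> (edges B)\<^sup>+" for u v
    using that
  proof (induction rule: trancl_induct)
    case (base v)
    then show ?case using W_edge[of u v] by blast
  next
    case (step v w)
    then show ?case using W_edge[of v w] by blast
  qed
  then have acyc: "acyclic (edges B)" unfolding acyclic_def by blast
  have src: "r \<in> R" by (simp add: R_def)
  \<comment> \<open>Reachability gives every node but \<open>r\<close> a predecessor; a predecessor
    of \<open>r\<close> would itself be reachable from \<open>r\<close> and close a cycle.\<close>
  have indeg: "(\<nexists>w. (w, u) \<in> edges B) \<longleftrightarrow> u = r" if u: "u \<in> R" for u
  proof
    assume no: "\<nexists>w. (w, u) \<in> edges B"
    have "(r, u) \<in> {(u, v). v \<in> children (lab u)}\<^sup>*" using u by (simp add: R_def)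
    then show "u = r"
    proof (cases rule: rtranclE)
      case (step w)
      then have "(w, u) \<in> edges B" by (simp add: edges_def R_def)
      with no show ?thesis by blast
    qed simp
  next
    assume [simp]: "u = r"
    show "\<nexists>w. (w, u) \<in> edges B"
    proof
      assume "\<exists>w. (w, u) \<in> edges B"
      then obtain w where w: "(w, r) \<in> edges B" by auto
      then have "(r, w) \<in> {(u, v). v \<in> children (lab u)}\<^sup>*" using edge[OF w] by (simp add: R_def)
      then have "(r, w) \<in> (edges B)\<^sup>*"
      proof (induction rule: rtrancl_induct)
        case (step v w)
        then have "(v, w) \<in> edges B" by (simp add: edges_def R_def)
        with step.IH show ?case by (rule rtrancl_into_rtrancl)
      qed simp
      with w acyc show False unfolding acyclic_def by (meson rtrancl_into_trancl1)
    qed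
  qed
  have dag: "bdd_dag B"
    unfolding bdd_dag_def
  proof (intro conjI allI)
    show "finite (nodes B)" using RS S(1) finite_subset by auto
    show "edges B \<subseteq> nodes B \<times> nodes B" using edge by auto
    show "\<exists>!u. u \<in> nodes B \<and> label B u = Sink b" for b
      using sink_exists[of b] sink_unique RS by (intro ex_ex1I) auto
  qed (use acyc src indeg in auto)
  have own: "x \<in> W u" if "u \<in> R" "decision_var (lab u) = Some x" for u x
    using that W[of u x] RS by (cases "lab u") auto
  \<comment> \<open>Distinctness alone is not inductive; the inclusion in \<open>W (hd us)\<close>
    keeps the variable of the preceding node from recurring.\<close>
  have "us \<noteq> [] \<Longrightarrow> set us \<subseteq> R \<Longrightarrow> successively (\<lambda>u v. (u, v) \<in> edges B) us \<Longrightarrow>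
      distinct (path_vars B us) \<and> set (path_vars B us) \<subseteq> W (hd us)" for us
  proof (induction us)
    case (Cons u us)
    show ?case
    proof (cases "us = []")
      case True
      then show ?thesis using own[of u] Cons.prems
        by (cases "decision_var (lab u)") (auto simp: path_vars_def List.map_filter_simps)
    next
      case False
      then have e: "(u, hd us) \<in> edges B" "successively (\<lambda>u v. (u, v) \<in> edges B) us"
        using Cons.prems by (cases us; simp)+
      obtain x where x: "decision_var (lab u) = Some x" "x \<in> W u" "W (hd us) \<subseteq> W u - {x}"
        using W_edge[OF e(1)] by blast
      moreover have "distinct (path_vars B us)" "set (path_vars B us) \<subseteq> W (hd us)"
        using Cons.IH[OF False _ e(2)] Cons.prems by auto
      ultimately show ?thesis by (auto simp: path_vars_def List.map_filter_simps)
    qed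
  qed simp
  then have "read_once B" unfolding read_once_def dpath_def by simp
  moreover have "decomposable B" using noconj RS by (auto simp: decomposable_def)
  ultimately have B: "and_fbdd B" using dag by (simp add: and_fbdd_def)
  then have "fbdd B" using noconj RS by (auto simp: fbdd_def)
  moreover have "bdd_size B \<le> card S"
    using S(1) RS by (simp add: bdd_size_def card_mono)
  moreover have "bdd_vars B = {x. \<exists>u\<in>R. decision_var (lab u) = Some x}"
    by (simp add: bdd_vars_def)
  moreover have "models B u \<sigma> \<longleftrightarrow> ev u \<sigma>" if "u \<in> R" for u \<sigma>
  proof -
    have "wf ((edges B)\<inverse>)"
      using dag finite_acyclic_wf_converse[of "edges B"] finite_subset
      unfolding bdd_dag_def by blast
    then show ?thesis using that
    proof (induction u rule: wf_induct_rule)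
      case (less u)
      then have u: "u \<in> S" "u \<in> nodes B" using RS by auto
      show ?case
      proof (cases "lab u")
        case (Sink b)
        then show ?thesis using ev_Sink[OF u(1) Sink] by (simp add: models_Sink)
      next
        case (Decision x u0 u1)
        let ?w = "if \<sigma> x then u1 else u0"
        have "(u, ?w) \<in> edges B" using u Decision by (simp add: edges_def)
        then have "models B ?w \<sigma> \<longleftrightarrow> ev ?w \<sigma>" using less.IH[of ?w] edge by blast
        then show ?thesis
          using ev_Decision[OF u(1) Decision] models_Decision[OF B u(2), of x u0 u1] Decision by simp
      qed (use noconj[OF u(1)] in simp)
    qed
  qed
  ultimately show ?thesis using src by (intro exI[of _ B]) simp_all
qed

section \<open>Canonical conjunctive normal forms\<close>

text \<open>One clause excludes each falsifying \<open>\<tau>\<close>. Functions that agree on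
  \<open>V\<close> give the same clause, so only finitely many clauses arise for finite
  \<open>V\<close> although \<open>\<tau>\<close> is total.\<close>

definition canonical_cnf :: "'v set \<Rightarrow> (('v \<Rightarrow> bool) \<Rightarrow> bool) \<Rightarrow> 'v cnf" where
  "canonical_cnf V f = (\<lambda>\<tau>. (\<lambda>x. (x, \<not> \<tau> x)) ` V) ` {\<tau>. \<not> f \<tau>}"

lemma is_cnf_canonical_cnf: "finite V \<Longrightarrow> is_cnf (canonical_cnf V f)"
  unfolding is_cnf_def canonical_cnf_def
  by (auto intro: finite_subset[of _ "Pow (V \<times> UNIV)"])

text \<open>A single falsifying assignment suffices, since its clause mentions every variable of
  \<open>V\<close>.\<close>

lemma cnf_vars_canonical_cnf: "\<not> f \<tau> \<Longrightarrow> cnf_vars (canonical_cnf V f) = V"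
  unfolding cnf_vars_def canonical_cnf_def by (auto simp: image_image)

text \<open>The clause of \<open>\<tau>\<close> fails exactly at the assignments agreeing with
  \<open>\<tau>\<close> on \<open>V\<close>; the hypothesis makes \<open>f\<close> false at all of
  them.\<close>

lemma sat_canonical_cnf:
  assumes "\<And>\<sigma> \<tau>. (\<And>x. x \<in> V \<Longrightarrow> \<sigma> x = \<tau> x) \<Longrightarrow> f \<sigma> \<longleftrightarrow> f \<tau>"
  shows "sat_cnf \<sigma> (canonical_cnf V f) \<longleftrightarrow> f \<sigma>"
proof -
  have "sat_cnf \<sigma> (canonical_cnf V f) \<longleftrightarrow> (\<forall>\<tau>. \<not> f \<tau> \<longrightarrow> (\<exists>x\<in>V. \<sigma> x \<noteq> \<tau> x))"
    unfolding sat_cnf_def canonical_cnf_def by simp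
  then show ?thesis using assms[of \<sigma>] by blast
qed

section \<open>The shifted inner product\<close>

text \<open>Residues modulo \<open>3\<close> keep rows, columns and selectors apart, and the indices
  below \<open>n\<close> of the three families fill \<open>{..<3 * n}\<close> exactly.\<close>

definition row_var :: "nat \<Rightarrow> nat" where "row_var i = 3 * i"
definition col_var :: "nat \<Rightarrow> nat" where "col_var j = 3 * j + 1"
definition sel_var :: "nat \<Rightarrow> nat" where "sel_var k = 3 * k + 2"

lemma var_eq_iff [simp]:
  "row_var i = row_var j \<longleftrightarrow> i = j" "col_var i = col_var j \<longleftrightarrow> i = j" "sel_var i = sel_var j \<longleftrightarrow> i = j"
  by (simp_all add: row_var_def col_var_def sel_var_def)

lemma var_neq [simp]:
  "row_var i \<noteq> col_var j" "col_var j \<noteq> row_var i" "row_var i \<noteq> sel_var k" "sel_var k \<noteq> row_var i"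
  "col_var j \<noteq> sel_var k" "sel_var k \<noteq> col_var j"
  unfolding row_var_def col_var_def sel_var_def by presburger+

lemma var_less_iff [simp]:
  "row_var i < 3 * n \<longleftrightarrow> i < n" "col_var i < 3 * n \<longleftrightarrow> i < n" "sel_var i < 3 * n \<longleftrightarrow> i < n"
  by (auto simp: row_var_def col_var_def sel_var_def)

lemma var_cases:
  obtains i where "x = row_var i" | i where "x = col_var i" | i where "x = sel_var i"
proof -
  have "x = 3 * (x div 3) \<or> x = 3 * (x div 3) + 1 \<or> x = 3 * (x div 3) + 2" by presburger
  then show ?thesis using that unfolding row_var_def col_var_def sel_var_def by blast
qed

text \<open>The column \<open>j\<close> with \<open>i + j = s\<close> modulo \<open>n\<close>, for
  \<open>i < n\<close>; the added \<open>n\<close> keeps natural subtraction from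
  truncating.\<close>

definition partner :: "nat \<Rightarrow> nat \<Rightarrow> nat \<Rightarrow> nat" where
  "partner n s i = (n + s - i) mod n"

definition hits :: "nat \<Rightarrow> nat \<Rightarrow> (nat \<Rightarrow> bool) \<Rightarrow> nat \<Rightarrow> bool" where
  "hits n s \<sigma> i \<longleftrightarrow> \<sigma> (row_var i) \<and> \<sigma> (col_var (partner n s i))"

text \<open>The starting index singles out the pairs still unread, so that the function at an
  intermediate node of the free diagram can be stated. The index \<open>k\<close> of
  \<open>shifted_from\<close> does the same for selectors.\<close>

definition parity_from :: "nat \<Rightarrow> nat \<Rightarrow> nat \<Rightarrow> (nat \<Rightarrow> bool) \<Rightarrow> bool" where
  "parity_from n s i \<sigma> \<longleftrightarrow> odd (card {k\<in>{i..<n}. hits n s \<sigma> k})"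

definition shifted_from :: "nat \<Rightarrow> nat \<Rightarrow> (nat \<Rightarrow> bool) \<Rightarrow> bool" where
  "shifted_from n k \<sigma> \<longleftrightarrow>
     (\<exists>s\<in>{k..<n}. \<sigma> (sel_var s) \<and> (\<forall>j\<in>{k..<s}. \<not> \<sigma> (sel_var j)) \<and> parity_from n s 0 \<sigma>)"

abbreviation shifted_product :: "nat \<Rightarrow> (nat \<Rightarrow> bool) \<Rightarrow> bool" where
  "shifted_product n \<equiv> shifted_from n 0"

section \<open>Partners and one-step recursions\<close>

lemma partner_less: "i < n \<Longrightarrow> partner n s i < n"
  by (simp add: partner_def)

lemma partner_add: "i < n \<Longrightarrow> j < n \<Longrightarrow> partner n ((i + j) mod n) i = j"
  by (cases "i + j < n") (auto simp: partner_def le_mod_geq not_less)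

lemma partner_partner: "i < n \<Longrightarrow> s < n \<Longrightarrow> partner n s (partner n s i) = i"
  by (cases "i \<le> s") (auto simp: partner_def le_mod_geq not_less)

lemma partner_eq_iff: "i < n \<Longrightarrow> j < n \<Longrightarrow> s < n \<Longrightarrow> partner n s i = partner n s j \<longleftrightarrow> i = j"
  by (metis partner_partner)

lemma parity_from_end: "n \<le> i \<Longrightarrow> \<not> parity_from n s i \<sigma>"
  by (simp add: parity_from_def)

lemma parity_from_step:
  assumes "i < n"
  shows "parity_from n s i \<sigma> \<longleftrightarrow> hits n s \<sigma> i \<noteq> parity_from n s (Suc i) \<sigma>"
proof -
  have "{k\<in>{i..<n}. hits n s \<sigma> k} =
      (if hits n s \<sigma> i then insert i {k\<in>{Suc i..<n}. hits n s \<sigma> k} else {k\<in>{Suc i..<n}. hits n s \<sigma> k})"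
    using assms by (auto simp: Suc_le_eq le_less)
  then show ?thesis by (simp add: parity_from_def)
qed

lemma shifted_from_end: "n \<le> k \<Longrightarrow> \<not> shifted_from n k \<sigma>"
  by (simp add: shifted_from_def)

lemma shifted_from_step:
  assumes "k < n"
  shows "shifted_from n k \<sigma> \<longleftrightarrow> (if \<sigma> (sel_var k) then parity_from n k 0 \<sigma> else shifted_from n (Suc k) \<sigma>)"
proof (cases "\<sigma> (sel_var k)")
  case True
  have "s = k" if "s \<in> {k..<n}" "\<forall>j\<in>{k..<s}. \<not> \<sigma> (sel_var j)" for s
    using that True by (metis atLeastLessThan_iff le_less order_refl)
  with True assms show ?thesis unfolding shifted_from_def by auto
next
  case False
  have "{k..<n} = insert k {Suc k..<n}" using assms by auto
  moreover have "(\<forall>j\<in>{k..<s}. \<not> \<sigma> (sel_var j)) \<longleftrightarrow> (\<forall>j\<in>{Suc k..<s}. \<not> \<sigma> (sel_var j))" for s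
    using False by (metis Suc_leD Suc_leI atLeastLessThan_iff le_neq_implies_less)
  ultimately show ?thesis using False unfolding shifted_from_def by simp
qed

lemma shifted_product_cong:
  assumes "\<And>x. x < 3 * n \<Longrightarrow> \<sigma> x = \<tau> x"
  shows "shifted_product n \<sigma> \<longleftrightarrow> shifted_product n \<tau>"
proof -
  have "hits n s \<sigma> i \<longleftrightarrow> hits n s \<tau> i" if "i < n" for s i
    using that partner_less[OF that, of s] by (simp add: hits_def assms)
  then have "parity_from n s 0 \<sigma> \<longleftrightarrow> parity_from n s 0 \<tau>" for s
    unfolding parity_from_def by (metis (mono_tags, lifting) Collect_cong atLeastLessThan_iff)
  then show ?thesis unfolding shifted_from_def by (simp add: assms)
qed

section \<open>A free diagram of quadratic size\<close>

datatype gate = Leaf bool | Sel nat | Row nat nat bool | Col nat nat bool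

text \<open>The diagram is to have natural numbers as nodes, so gates are encoded by
  \<open>to_nat\<close>.\<close>

instance gate :: countable by countable_datatype

definition after :: "nat \<Rightarrow> nat \<Rightarrow> nat \<Rightarrow> bool \<Rightarrow> gate" where
  "after n s i p = (if Suc i < n then Row s (Suc i) p else Leaf p)"

text \<open>The flag of a \<open>Row\<close> or \<open>Col\<close> gate is the parity of the products read so far.\<close>

fun gate_label :: "nat \<Rightarrow> gate \<Rightarrow> (nat, nat) node_label" where
  "gate_label n (Leaf b) = Sink b"
| "gate_label n (Sel k) = Decision (sel_var k)
     (to_nat (if Suc k < n then Sel (Suc k) else Leaf False)) (to_nat (Row k 0 False))"
| "gate_label n (Row s i p) = Decision (row_var i) (to_nat (after n s i p)) (to_nat (Col s i p))"
| "gate_label n (Col s i p) = Decision (col_var (partner n s i))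
     (to_nat (after n s i p)) (to_nat (after n s i (\<not> p)))"

text \<open>A \<open>Col\<close> gate is entered only after its row variable was read as true, so
  the product of the current pair equals the column variable alone. Inequality of truth values
  serves as addition modulo two.\<close>

fun gate_fun :: "nat \<Rightarrow> gate \<Rightarrow> (nat \<Rightarrow> bool) \<Rightarrow> bool" where
  "gate_fun n (Leaf b) \<sigma> \<longleftrightarrow> b"
| "gate_fun n (Sel k) \<sigma> \<longleftrightarrow> shifted_from n k \<sigma>"
| "gate_fun n (Row s i p) \<sigma> \<longleftrightarrow> p \<noteq> parity_from n s i \<sigma>"
| "gate_fun n (Col s i p) \<sigma> \<longleftrightarrow> p \<noteq> (\<sigma> (col_var (partner n s i)) \<noteq> parity_from n s (Suc i) \<sigma>)"

text \<open>These sets are the decreasing bounds for \<open>fbdd_of_labelling\<close>.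
  \<open>Sel\<close> keeps all rows and columns, since the shift is not yet known there.\<close>

fun gate_vars :: "nat \<Rightarrow> gate \<Rightarrow> nat set" where
  "gate_vars n (Leaf b) = {}"
| "gate_vars n (Sel k) = sel_var ` {k..<n} \<union> row_var ` {..<n} \<union> col_var ` {..<n}"
| "gate_vars n (Row s i p) = row_var ` {i..<n} \<union> (\<lambda>i. col_var (partner n s i)) ` {i..<n}"
| "gate_vars n (Col s i p) = row_var ` {Suc i..<n} \<union> (\<lambda>i. col_var (partner n s i)) ` {i..<n}"

definition gates :: "nat \<Rightarrow> gate set" where
  "gates n = range Leaf \<union> Sel ` {..<n}
     \<union> (\<lambda>(s, i, p). Row s i p) ` ({..<n} \<times> {..<n} \<times> UNIV)
     \<union> (\<lambda>(s, i, p). Col s i p) ` ({..<n} \<times> {..<n} \<times> UNIV)"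

lemma gates_iff:
  "Leaf b \<in> gates n" "Sel k \<in> gates n \<longleftrightarrow> k < n"
  "Row s i p \<in> gates n \<longleftrightarrow> s < n \<and> i < n" "Col s i p \<in> gates n \<longleftrightarrow> s < n \<and> i < n"
  by (auto simp: gates_def image_iff)

lemma after_gates: "s < n \<Longrightarrow> after n s i p \<in> gates n"
  by (simp add: after_def gates_iff)

lemma finite_gates: "finite (gates n)"
  by (simp add: gates_def)

lemma card_gates: "card (gates n) \<le> 2 + n + 4 * n\<^sup>2"
proof -
  let ?T = "{..<n} \<times> {..<n} \<times> (UNIV :: bool set)"
  let ?A = "range Leaf" and ?B = "Sel ` {..<n}"
  let ?C = "(\<lambda>(s, i, p). Row s i p) ` ?T" and ?D = "(\<lambda>(s, i, p). Col s i p) ` ?T"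
  have "card ?A \<le> 2" by (simp add: UNIV_bool card_insert_if)
  moreover have "card ?B \<le> n" using card_image_le[of "{..<n}" Sel] by simp
  moreover have T: "card (f ` ?T) \<le> 2 * n\<^sup>2" for f :: "_ \<Rightarrow> gate"
    using card_image_le[of ?T f] by (simp add: card_cartesian_product power2_eq_square)
  moreover have "card ?C \<le> 2 * n\<^sup>2" "card ?D \<le> 2 * n\<^sup>2" by (rule T)+
  ultimately show ?thesis
    using card_Un_le[of ?A ?B] card_Un_le[of "?A \<union> ?B" ?C] card_Un_le[of "?A \<union> ?B \<union> ?C" ?D]
    unfolding gates_def by linarith
qed

lemma shifted_product_fbdd:
  assumes n: "0 < n"
  shows "\<exists>B :: (nat, nat) bdd. fbdd B \<and> bdd_size B \<le> 2 + n + 4 * n\<^sup>2 \<and> bdd_vars B = {..<3 * n} \<and>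
    (\<forall>\<sigma>. models B (source B) \<sigma> \<longleftrightarrow> shifted_product n \<sigma>)"
proof -
  let ?lab = "\<lambda>m. gate_label n (from_nat m)"
  let ?E = "{(u, v). v \<in> children (?lab u)}"
  define R where "R = {v. (to_nat (Sel 0), v) \<in> ?E\<^sup>*}"
  have step: "to_nat h \<in> R" if "to_nat g \<in> R" "to_nat h \<in> children (gate_label n g)" for g h
    using that unfolding R_def by (auto intro: rtrancl_into_rtrancl)
  \<comment> \<open>Representing the function demands exactly the variables below
    \<open>3 * n\<close>, so every variable needs a reachable gate. Gates with flag
    \<open>False\<close> are enough for that.\<close>
  have sel: "k < n \<Longrightarrow> to_nat (Sel k) \<in> R" for k
  proof (induction k)
    case (Suc k)
    show ?case by (rule step[of "Sel k"]) (use Suc in auto)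
  qed (simp add: R_def)
  have row: "s < n \<Longrightarrow> i < n \<Longrightarrow> to_nat (Row s i False) \<in> R" for s i
  proof (induction i)
    case 0
    show ?case by (rule step[of "Sel s"], rule sel) (use 0 in auto)
  next
    case (Suc i)
    show ?case by (rule step[of "Row s i False"]) (use Suc in \<open>auto simp: after_def\<close>)
  qed
  have col: "s < n \<Longrightarrow> i < n \<Longrightarrow> to_nat (Col s i False) \<in> R" for s i
    by (rule step[of "Row s i False"], rule row) auto
  \<comment> \<open>With flag \<open>False\<close>, the two children of the last column gate are the
    two leaves, so both sinks are reachable.\<close>
  have leaf: "to_nat (Leaf b) \<in> R" for b
    by (rule step[of "Col 0 (n - 1) False"], rule col) (use n in \<open>auto simp: after_def\<close>)
  have R_gates: "R \<subseteq> to_nat ` gates n"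
  proof
    fix v assume "v \<in> R"
    then have "(to_nat (Sel 0), v) \<in> ?E\<^sup>*" by (simp add: R_def)
    then show "v \<in> to_nat ` gates n"
    proof (induction rule: rtrancl_induct)
      case base
      then show ?case using n by (simp add: gates_iff)
    next
      case (step v w)
      then obtain g where "v = to_nat g" "g \<in> gates n" by blast
      with step.hyps(2) n show ?case
        by (cases g) (auto simp: gates_iff after_gates)
    qed
  qed
  have vars: "{x. \<exists>u\<in>R. decision_var (?lab u) = Some x} = {..<3 * n}"
  proof (intro set_eqI iffI)
    fix x assume "x \<in> {x. \<exists>u\<in>R. decision_var (?lab u) = Some x}"
    then obtain g where "g \<in> gates n" "decision_var (gate_label n g) = Some x"
      using R_gates by force
    then show "x \<in> {..<3 * n}"
    proof (cases g)
      case (Col s i p)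
      with \<open>g \<in> gates n\<close> \<open>decision_var (gate_label n g) = Some x\<close> partner_less[of i n s]
      show ?thesis by (auto simp: gates_iff)
    qed (auto simp: gates_iff)
  next
    fix x assume x: "x \<in> {..<3 * n}"
    have "\<exists>g. to_nat g \<in> R \<and> decision_var (gate_label n g) = Some x"
    proof (cases x rule: var_cases)
      case (1 i)
      with x row[OF n, of i] show ?thesis by (intro exI[of _ "Row 0 i False"]) simp
    next
      case (2 i)
      with x have "i < n" by simp
      \<comment> \<open>Column \<open>i\<close> is witnessed by the first pair read under shift
        \<open>i\<close>.\<close>
      then have "partner n i 0 = i" by (simp add: partner_def)
      with 2 col[OF \<open>i < n\<close> n] show ?thesis by (intro exI[of _ "Col i 0 False"]) simp
    next
      case (3 i)
      with x sel[of i] show ?thesis by (intro exI[of _ "Sel i"]) simp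
    qed
    then show "x \<in> {x. \<exists>u\<in>R. decision_var (?lab u) = Some x}" by force
  qed
  \<comment> \<open>For a fixed shift \<open>partner\<close> is injective, so the column just read
    is not the partner of any later row.\<close>
  have W: "x \<in> gate_vars n g \<and> gate_vars n (from_nat w) \<subseteq> gate_vars n g - {x}"
    if g: "g \<in> gates n" "gate_label n g = Decision x u0 u1" "w \<in> {u0, u1}" for g x u0 u1 w
    using g by (cases g) (auto simp: gates_iff after_def partner_eq_iff partner_less split: if_splits)
  have after_fun: "gate_fun n (after n s i p) \<sigma> \<longleftrightarrow> p \<noteq> parity_from n s (Suc i) \<sigma>" for s i p \<sigma>
    by (auto simp: after_def parity_from_end)
  have sel_fun: "gate_fun n (if Suc k < n then Sel (Suc k) else Leaf False) \<sigma> \<longleftrightarrow> shifted_from n (Suc k) \<sigma>"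
    for k \<sigma> by (simp add: shifted_from_end)
  have ev: "gate_fun n g \<sigma> \<longleftrightarrow> gate_fun n (from_nat (if \<sigma> x then u1 else u0)) \<sigma>"
    if g: "g \<in> gates n" "gate_label n g = Decision x u0 u1" for g x u0 u1 \<sigma>
  proof (cases g)
    case (Sel k)
    then show ?thesis using g by (auto simp: gates_iff shifted_from_step sel_fun)
  next
    case (Row s i p)
    then show ?thesis using g by (auto simp: gates_iff parity_from_step hits_def after_fun)
  next
    case (Col s i p)
    then show ?thesis using g by (auto simp: gates_iff after_fun)
  qed (use g in simp)
  have "\<exists>B :: (nat, nat) bdd. fbdd B \<and> bdd_size B \<le> card (to_nat ` gates n) \<and>
    bdd_vars B = {x. \<exists>u\<in>{v. (to_nat (Sel 0), v) \<in> ?E\<^sup>*}. decision_var (?lab u) = Some x} \<and>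
    (\<forall>\<sigma>. models B (source B) \<sigma> \<longleftrightarrow> gate_fun n (from_nat (to_nat (Sel 0))) \<sigma>)"
  proof (rule fbdd_of_labelling[where lab = ?lab and W = "\<lambda>m. gate_vars n (from_nat m)"
        and ev = "\<lambda>m. gate_fun n (from_nat m)" and S = "to_nat ` gates n"])
    show "finite (to_nat ` gates n)" by (simp add: finite_gates)
    show "to_nat (Sel 0) \<in> to_nat ` gates n" using n by (simp add: gates_iff)
    fix u assume "u \<in> to_nat ` gates n"
    then obtain g where u: "u = to_nat g" "g \<in> gates n" by blast
    show "children (?lab u) \<subseteq> to_nat ` gates n"
      using u n by (cases g) (auto simp: gates_iff after_gates)
    show "?lab u \<noteq> Conj u0 u1" for u0 u1
      using u by (cases g) auto
    show "x \<in> gate_vars n (from_nat u) \<and> gate_vars n (from_nat w) \<subseteq> gate_vars n (from_nat u) - {x}"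
      if "?lab u = Decision x u0 u1" "w \<in> {u0, u1}" for x u0 u1 w
      using W[OF u(2) _ that(2)] that(1) u(1) by simp
    show "gate_fun n (from_nat u) \<sigma> \<longleftrightarrow> b" if "?lab u = Sink b" for b \<sigma>
      using u that by (cases g) auto
    show "gate_fun n (from_nat u) \<sigma> \<longleftrightarrow> gate_fun n (from_nat (if \<sigma> x then u1 else u0)) \<sigma>"
      if "?lab u = Decision x u0 u1" for x u0 u1 \<sigma>
      using ev[OF u(2), of x u0 u1] that u(1) by simp
    fix v b assume "v \<in> to_nat ` gates n" and l: "?lab u = Sink b" "?lab v = Sink b"
    then obtain h :: gate where "v = to_nat h" by blast
    with u l show "u = v" by (cases g; cases h) auto
  next
    fix b show "\<exists>u\<in>{v. (to_nat (Sel 0), v) \<in> ?E\<^sup>*}. ?lab u = Sink b"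
      using leaf[of b] unfolding R_def by (intro bexI[of _ "to_nat (Leaf b)"]) auto
  qed
  then obtain B :: "(nat, nat) bdd" where B: "fbdd B" "bdd_size B \<le> card (to_nat ` gates n)"
    "bdd_vars B = {..<3 * n}" "\<And>\<sigma>. models B (source B) \<sigma> \<longleftrightarrow> shifted_product n \<sigma>"
    unfolding vars[unfolded R_def] by auto
  have "bdd_size B \<le> 2 + n + 4 * n\<^sup>2"
    using B(2) card_image_le[OF finite_gates[of n], of to_nat] card_gates[of n] by linarith
  with B show ?thesis by blast
qed

section \<open>The lower bound\<close>

text \<open>Let the rank of \<open>v\<close> in \<open>D\<close> be the number of elements of
  \<open>D\<close> strictly below it. Ranks are distinct and less than \<open>card D\<close>, so
  each number below \<open>card D\<close> is a rank, and the strict predecessors of the element of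
  rank \<open>k\<close> form the required set. The implication is downward closure in contrapositive
  form.\<close>

lemma exists_down_set_of_card:
  assumes lin: "linear_order_on V \<pi>" and D: "finite D" "D \<subseteq> V" and k: "k < card D"
  shows "\<exists>P. card (D \<inter> P) = k \<and> (\<forall>x y. (x, y) \<in> \<pi> \<and> x \<noteq> y \<and> x \<notin> P \<longrightarrow> y \<notin> P)"
proof -
  let ?P = "\<lambda>v. {u. (u, v) \<in> \<pi> \<and> u \<noteq> v}"
  have tr: "trans \<pi>" and an: "antisym \<pi>" and tot: "total_on V \<pi>"
    using lin by (auto simp: order_on_defs)
  have down: "x \<in> ?P v" if "(x, y) \<in> \<pi>" "x \<noteq> y" "y \<in> ?P v" for x y v
    using that transD[OF tr, of x y v] antisymD[OF an, of x y] by auto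
  have up: "x \<in> ?P v" if "x \<in> ?P u" "(u, v) \<in> \<pi>" "u \<noteq> v" for x u v
    using that transD[OF tr, of x u v] antisymD[OF an, of u v] by auto
  let ?r = "\<lambda>v. card (D \<inter> ?P v)"
  have less: "?r u < ?r v" if "u \<in> D" "(u, v) \<in> \<pi>" "u \<noteq> v" for u v
  proof (intro psubset_card_mono psubsetI)
    show "finite (D \<inter> ?P v)" using D by simp
    show "D \<inter> ?P u \<subseteq> D \<inter> ?P v" using up[OF _ that(2,3)] by blast
    show "D \<inter> ?P u \<noteq> D \<inter> ?P v" using that by blast
  qed
  have "inj_on ?r D"
  proof (rule inj_onI, rule ccontr)
    fix u v assume uv: "u \<in> D" "v \<in> D" "?r u = ?r v" "u \<noteq> v"
    then have "(u, v) \<in> \<pi> \<or> (v, u) \<in> \<pi>" using tot D(2) by (auto simp: total_on_def)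
    then show False using less[of u v] less[of v u] uv by auto
  qed
  then have "card (?r ` D) = card D" by (rule card_image)
  moreover have "?r ` D \<subseteq> {..<card D}"
  proof (intro image_subsetI)
    fix v assume "v \<in> D"
    then have "D \<inter> ?P v \<subset> D" by blast
    then show "?r v \<in> {..<card D}" using D(1) by (simp add: psubset_card_mono)
  qed
  ultimately have "?r ` D = {..<card D}" by (intro card_subset_eq) auto
  then have "k \<in> ?r ` D" using k by simp
  then obtain v where "?r v = k" by blast
  then show ?thesis using down by (intro exI[of _ "?P v"]) blast
qed

text \<open>Labels increase along every path, so once a decision node tests a variable outside the
  initial segment \<open>P\<close>, no variable of \<open>P\<close> can follow.\<close>

lemma and_obdd_prefix:
  assumes "and_obdd B" and D: "D \<subseteq> bdd_vars B" "finite D" "k < card D"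
  obtains P where "card (D \<inter> P) = k"
    and "\<And>u x u0 u1 y w. u \<in> nodes B \<Longrightarrow> label B u = Decision x u0 u1 \<Longrightarrow> x \<notin> P \<Longrightarrow>
        w \<in> {u0, u1} \<Longrightarrow> y \<in> vars_below B w \<Longrightarrow> y \<notin> P"
proof -
  obtain V \<pi> where V: "bdd_vars B \<subseteq> V" "linear_order_on V \<pi>"
    and sorted: "\<And>us. dpath B us \<Longrightarrow> sorted_wrt (\<lambda>x y. (x, y) \<in> \<pi> \<and> x \<noteq> y) (path_vars B us)"
    and dag: "bdd_dag B"
    using assms(1) by (auto simp: and_obdd_def and_fbdd_def)
  obtain P where P: "card (D \<inter> P) = k" "\<And>x y. (x, y) \<in> \<pi> \<Longrightarrow> x \<noteq> y \<Longrightarrow> x \<notin> P \<Longrightarrow> y \<notin> P"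
    using exists_down_set_of_card[OF V(2) D(2) _ D(3)] D(1) V(1) by blast
  have "y \<notin> P" if u: "u \<in> nodes B" "label B u = Decision x u0 u1" "x \<notin> P"
    "w \<in> {u0, u1}" "y \<in> vars_below B w" for u x u0 u1 y w
  proof -
    obtain us where "dpath B (u # us)" "path_vars B (u # us) = x # path_vars B us"
      "y \<in> set (path_vars B us)"
      using decision_dpath[OF dag u(1,2,4,5)] by blast
    then have "(x, y) \<in> \<pi> \<and> x \<noteq> y" using sorted[of "u # us"] by simp
    then show ?thesis using P(2) u(3) by blast
  qed
  with P(1) that show thesis by blast
qed

section \<open>Inner products across the prefix\<close>

lemma odd_card_toggle:
  assumes "finite A" "finite B" "\<And>x. x \<noteq> a \<Longrightarrow> x \<in> A \<longleftrightarrow> x \<in> B" "a \<in> A \<longleftrightarrow> a \<notin> B"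
  shows "odd (card A) \<longleftrightarrow> \<not> odd (card B)"
proof (cases "a \<in> A")
  case True
  with assms(3,4) have "A = insert a B" by (intro set_eqI) (metis insert_iff)
  with True assms(2,4) show ?thesis by simp
next
  case False
  with assms(3,4) have "B = insert a A" by (intro set_eqI) (metis insert_iff)
  with False assms(1) show ?thesis by simp
qed

text \<open>Fixing \<open>Z\<close> turns the diagram into one for the inner product of \<open>u\<close> and \<open>v\<close>; the
  pairs in \<open>I\<close> are separated by the prefix \<open>P\<close>.\<close>

lemma inner_product_size:
  assumes B: "and_fbdd B"
    and P: "\<And>u x u0 u1 y w. u \<in> nodes B \<Longrightarrow> label B u = Decision x u0 u1 \<Longrightarrow> x \<notin> P \<Longrightarrow>
        w \<in> {u0, u1} \<Longrightarrow> y \<in> vars_below B w \<Longrightarrow> y \<notin> P"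
    and f: "\<And>\<sigma>. (\<And>z. z \<in> Z \<Longrightarrow> \<sigma> z = \<rho> z) \<Longrightarrow>
        models B (source B) \<sigma> \<longleftrightarrow> odd (card {i\<in>N. \<sigma> (u i) \<and> \<sigma> (v i)})"
    and N: "finite N" and inj: "inj_on u N" "inj_on v N"
    and disj: "u ` N \<inter> v ` N = {}" "u ` N \<inter> Z = {}" "v ` N \<inter> Z = {}"
    and I: "I \<subseteq> N" "u ` I \<subseteq> P" "v ` I \<inter> P = {}"
  shows "2 ^ (card I - 1) \<le> bdd_size B"
proof (cases "I = {}")
  case True
  \<comment> \<open>The truncated exponent is \<open>0\<close> here, so a single node
    suffices.\<close>
  have "source B \<in> nodes B" "finite (nodes B)"
    using B by (auto simp: and_fbdd_def bdd_dag_def)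
  then show ?thesis using True by (auto simp: bdd_size_def Suc_le_eq card_gt_0_iff)
next
  case False
  then obtain i0 where i0: "i0 \<in> I" by blast
  have fI: "finite I" using I(1) N finite_subset by blast
  \<comment> \<open>Every \<open>K\<close> contains \<open>i0\<close>, which makes all the
    subfunctions linear in \<open>v i0\<close>; this is what costs one in the exponent.\<close>
  define J where "J = insert i0 ` Pow (I - {i0})"
  have J: "i0 \<in> K \<and> K \<subseteq> I" if "K \<in> J" for K using that i0 by (auto simp: J_def)
  have "inj_on (insert i0) (Pow (I - {i0}))"
    by (rule inj_onI) (metis Diff_insert_absorb PowD insert_Diff1 subset_Diff_insert)
  then have cJ: "card J = 2 ^ (card I - 1)"
    using fI i0 by (simp add: J_def card_image card_Pow)
  \<comment> \<open>Apart from \<open>Z\<close>, exactly the variables \<open>u i\<close> with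
    \<open>i \<in> K\<close> are true, so the part of the assignment inside \<open>P\<close> encodes
    \<open>K\<close>.\<close>
  define \<sigma> where "\<sigma> K x = (if x \<in> Z then \<rho> x else x \<in> u ` K)" for K x
  have ov: "models B (source B) (override_on \<tau> (\<sigma> K) (P \<union> Z)) \<longleftrightarrow>
      odd (card {i\<in>N. override_on \<tau> (\<sigma> K) (P \<union> Z) (u i) \<and> override_on \<tau> (\<sigma> K) (P \<union> Z) (v i)})" for K \<tau>
    by (rule f) (simp add: override_on_def \<sigma>_def)
  have \<sigma>u: "\<sigma> K (u i) \<longleftrightarrow> i \<in> K" if "K \<in> J" "i \<in> N" for K i
  proof -
    have "u i \<notin> Z" using that disj by blast
    moreover have "K \<subseteq> N" using J[OF that(1)] I(1) by blast
    ultimately show ?thesis using inj(1) that(2) by (auto simp: \<sigma>_def dest: inj_onD)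
  qed
  have \<sigma>v: "\<not> \<sigma> K (v i)" if "K \<in> J" "i \<in> N" for K i
  proof -
    have "v i \<notin> Z" using that disj by blast
    moreover have "K \<subseteq> N" using J[OF that(1)] I(1) by blast
    ultimately show ?thesis using disj(1) that(2) by (auto simp: \<sigma>_def)
  qed
  have IP: "u i \<in> P" "v i \<notin> P \<union> Z" if "i \<in> I" for i using that I disj by blast+
  have "card J \<le> bdd_size B"
  proof (rule card_linear_restrictions_le[where P = P and Z = Z and \<sigma> = \<sigma> and \<rho> = \<rho>, OF B])
    show "y \<notin> P" if "u \<in> nodes B" "label B u = Decision x u0 u1" "x \<notin> P"
      "w \<in> {u0, u1}" "y \<in> vars_below B w" for u x u0 u1 y w
      using that by (rule P)
    show "\<sigma> K z = \<rho> z" if "z \<in> Z" for K z using that by (simp add: \<sigma>_def)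
  next
    fix K assume K: "K \<in> J"
    \<comment> \<open>Since \<open>u i0\<close> lies in \<open>P\<close> and is set to true, the
      pair \<open>i0\<close> contributes the value of \<open>v i0\<close>, which is left free and
      occurs in no other pair.\<close>
    let ?y = "v i0"
    have "models B (source B) (override_on (\<tau>(?y := \<not> \<tau> ?y)) (\<sigma> K) (P \<union> Z)) \<longleftrightarrow>
        \<not> models B (source B) (override_on \<tau> (\<sigma> K) (P \<union> Z))" for \<tau>
    proof -
      let ?A = "\<lambda>\<tau>. {i\<in>N. override_on \<tau> (\<sigma> K) (P \<union> Z) (u i) \<and> override_on \<tau> (\<sigma> K) (P \<union> Z) (v i)}"
      let ?\<tau> = "\<tau>(?y := \<not> \<tau> ?y)"
      have "i0 \<in> N" "i0 \<in> K" using i0 I(1) J[OF K] by auto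
      have same: "i \<in> ?A ?\<tau> \<longleftrightarrow> i \<in> ?A \<tau>" if "i \<noteq> i0" for i
      proof -
        have "u i \<noteq> ?y" "v i \<noteq> ?y" if "i \<in> N"
          using that \<open>i \<noteq> i0\<close> \<open>i0 \<in> N\<close> disj(1) inj(2) by (auto dest: inj_onD)
        then show ?thesis by (auto simp: override_on_def)
      qed
      have at: "i0 \<in> ?A \<tau>' \<longleftrightarrow> \<tau>' ?y" for \<tau>'
        using IP[OF i0] \<sigma>u[OF K \<open>i0 \<in> N\<close>] \<open>i0 \<in> N\<close> \<open>i0 \<in> K\<close> by (simp add: override_on_def)
      have fin: "finite (?A \<tau>')" for \<tau>' using N by simp
      have toggle: "i0 \<in> ?A ?\<tau> \<longleftrightarrow> i0 \<notin> ?A \<tau>" by (simp only: at fun_upd_same)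
      have "odd (card (?A ?\<tau>)) \<longleftrightarrow> \<not> odd (card (?A \<tau>))"
        by (rule odd_card_toggle[OF fin fin _ toggle]) (rule same)
      then show ?thesis unfolding ov .
    qed
    then show "\<exists>y. y \<notin> P \<union> Z \<and> (\<forall>\<tau>.
        models B (source B) (override_on (\<tau>(y := \<not> \<tau> y)) (\<sigma> K) (P \<union> Z)) \<longleftrightarrow>
        \<not> models B (source B) (override_on \<tau> (\<sigma> K) (P \<union> Z)))"
      using IP[OF i0] by blast
  next
    fix K L assume KL: "K \<in> J" "L \<in> J" "K \<noteq> L"
    then obtain i where i: "i \<in> I" "i \<in> K \<longleftrightarrow> i \<notin> L" using J by blast
    \<comment> \<open>Outside the fixed variables only \<open>v i\<close> is true, so
      \<open>i\<close> is the only pair that can contribute, and it does so exactly for sets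
      containing \<open>i\<close>.\<close>
    define \<tau> where "\<tau> = (\<lambda>x. x = v i)"
    have m: "models B (source B) (override_on \<tau> (\<sigma> M) (P \<union> Z)) \<longleftrightarrow> i \<in> M" if M: "M \<in> J" for M
    proof -
      have "i \<in> N" using i I by blast
      have "override_on \<tau> (\<sigma> M) (P \<union> Z) (v k) \<longleftrightarrow> k = i" if "k \<in> N" for k
        using \<sigma>v[OF M that] IP[OF i(1)] inj_onD[OF inj(2), of k i] that \<open>i \<in> N\<close>
        by (auto simp: override_on_def \<tau>_def)
      moreover have "override_on \<tau> (\<sigma> M) (P \<union> Z) (u i) \<longleftrightarrow> i \<in> M"
        using \<sigma>u[OF M \<open>i \<in> N\<close>] IP[OF i(1)] by (simp add: override_on_def)
      ultimately have "{k\<in>N. override_on \<tau> (\<sigma> M) (P \<union> Z) (u k) \<and> override_on \<tau> (\<sigma> M) (P \<union> Z) (v k)} =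
          (if i \<in> M then {i} else {})"
        using \<open>i \<in> N\<close> by auto
      then show ?thesis unfolding ov by simp
    qed
    show "\<exists>\<tau>. models B (source B) (override_on \<tau> (\<sigma> K) (P \<union> Z)) \<noteq>
        models B (source B) (override_on \<tau> (\<sigma> L) (P \<union> Z))"
      using m[OF KL(1)] m[OF KL(2)] i(2) by blast
  qed
  with cJ show ?thesis by simp
qed

text \<open>Averaging: every pair in \<open>A \<times> C\<close> is matched by exactly one shift,
  the sum of its indices modulo \<open>n\<close>, so the \<open>n\<close> shifts together match
  \<open>card A * card C\<close> pairs. Multiplying by \<open>n\<close> avoids a division.\<close>

lemma exists_shift_many_partners:
  assumes A: "A \<subseteq> {..<n}" "C \<subseteq> {..<n}" and n: "0 < n"
  shows "\<exists>s<n. card A * card C \<le> n * card {i\<in>A. partner n s i \<in> C}"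
proof (rule ccontr)
  assume no: "\<not> ?thesis"
  have fin: "finite A" "finite C" using A finite_subset by auto
  let ?F = "\<lambda>s. {p \<in> A \<times> C. (fst p + snd p) mod n = s}"
  have F: "fst p \<in> A \<and> snd p \<in> C \<and> partner n s (fst p) = snd p" if "p \<in> ?F s" for p s
  proof -
    have "fst p < n" "snd p < n" using that A by auto
    from partner_add[OF this] that show ?thesis by auto
  qed
  have le: "card (?F s) \<le> card {i\<in>A. partner n s i \<in> C}" for s
  proof (rule card_inj_on_le)
    show "fst ` ?F s \<subseteq> {i\<in>A. partner n s i \<in> C}"
    proof (rule image_subsetI)
      fix p assume "p \<in> ?F s"
      from F[OF this] show "fst p \<in> {i\<in>A. partner n s i \<in> C}" by simp
    qed
    show "inj_on fst (?F s)"
    proof (rule inj_onI)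
      fix p q assume "p \<in> ?F s" "q \<in> ?F s" "fst p = fst q"
      with F[of p s] F[of q s] show "p = q" by (metis prod_eqI)
    qed
  qed (use fin in simp)
  have "card A * card C = card (A \<times> C)" by (simp add: card_cartesian_product)
  also have "A \<times> C = (\<Union>s<n. ?F s)" using n by auto
  also have "card \<dots> \<le> (\<Sum>s<n. card (?F s))" by (rule card_UN_le) simp
  finally have "n * (card A * card C) \<le> (\<Sum>s<n. n * card (?F s))"
    by (simp add: sum_distrib_left[symmetric])
  also have "\<dots> \<le> (\<Sum>s<n. n * card {i\<in>A. partner n s i \<in> C})"
    by (intro sum_mono mult_le_mono2 le)
  also have "\<dots> < (\<Sum>s<n. card A * card C)"
    using no n by (intro sum_strict_mono) (auto simp: not_le)
  finally show False by simp
qed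

section \<open>From the shifted product to an inner product\<close>

lemma shifted_product_fixed_shift:
  assumes "s < n" "\<And>k. k < n \<Longrightarrow> \<sigma> (sel_var k) \<longleftrightarrow> k = s"
  shows "shifted_product n \<sigma> \<longleftrightarrow> odd (card {i\<in>{..<n}. \<sigma> (row_var i) \<and> \<sigma> (col_var (partner n s i))})"
proof -
  have "shifted_product n \<sigma> \<longleftrightarrow> parity_from n s 0 \<sigma>"
    using assms unfolding shifted_from_def by (auto; metis less_trans)
  then show ?thesis by (simp add: parity_from_def hits_def lessThan_atLeast0)
qed

text \<open>Here \<open>m\<close> counts pairs separated by a prefix that contains exactly
  \<open>n\<close> of the row and column variables. Rows or columns make up at least half of these,
  and equally many of the other kind lie outside. This leaves at least \<open>n * n / 4\<close>
  candidate pairs, and some shift matches at least \<open>n / 4\<close> of them.\<close>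

lemma shifted_product_and_obdd_size:
  fixes B :: "('n, nat) bdd"
  assumes B: "and_obdd B" "bdd_vars B = {..<3 * n}" "\<And>\<sigma>. models B (source B) \<sigma> \<longleftrightarrow> shifted_product n \<sigma>"
    and n: "0 < n"
  shows "\<exists>m. n \<le> 4 * m \<and> 2 ^ (m - 1) \<le> bdd_size B"
proof -
  have fB: "and_fbdd B" using B(1) by (simp add: and_obdd_def)
  let ?D = "row_var ` {..<n} \<union> col_var ` {..<n}"
  have inj: "inj row_var" "inj col_var" by (auto intro: injI)
  have cD: "card ?D = 2 * n"
    using inj by (subst card_Un_disjoint) (auto simp: card_image inj_on_def)
  obtain P where P: "card (?D \<inter> P) = n"
    and down: "\<And>u x u0 u1 y w. u \<in> nodes B \<Longrightarrow> label B u = Decision x u0 u1 \<Longrightarrow> x \<notin> P \<Longrightarrow>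
        w \<in> {u0, u1} \<Longrightarrow> y \<in> vars_below B w \<Longrightarrow> y \<notin> P"
    by (rule and_obdd_prefix[OF B(1), of ?D n]) (use B(2) cD n in auto)
  define X where "X = {i\<in>{..<n}. row_var i \<in> P}"
  define Y where "Y = {j\<in>{..<n}. col_var j \<in> P}"
  have XY: "X \<subseteq> {..<n}" "Y \<subseteq> {..<n}" "finite X" "finite Y" by (auto simp: X_def Y_def)
  have "?D \<inter> P = row_var ` X \<union> col_var ` Y" by (auto simp: X_def Y_def)
  then have "n = card (row_var ` X \<union> col_var ` Y)" using P by simp
  also have "\<dots> = card (row_var ` X) + card (col_var ` Y)"
    using XY by (intro card_Un_disjoint) auto
  finally have cXY: "n = card X + card Y"
    using inj by (simp add: card_image inj_on_def)
  \<comment> \<open>All selectors are fixed, whether or not they lie in \<open>P\<close>.\<close>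
  let ?Z = "sel_var ` {..<n}"
  \<comment> \<open>\<open>u\<close> names the side inside \<open>P\<close>, which is the rows in
    one case below and the columns in the other.\<close>
  have size: "2 ^ (card I - 1) \<le> bdd_size B"
    if s: "s < n" and uv: "(u, v) = (row_var, col_var \<circ> partner n s) \<or> (u, v) = (col_var \<circ> partner n s, row_var)"
      and I: "I \<subseteq> {..<n}" "u ` I \<subseteq> P" "v ` I \<inter> P = {}" for s u v I
  proof (rule inner_product_size[OF fB down, where Z = ?Z and \<rho> = "\<lambda>z. z = sel_var s"])
    fix \<sigma> assume "\<And>z. z \<in> ?Z \<Longrightarrow> \<sigma> z = (z = sel_var s)"
    then have "shifted_product n \<sigma> \<longleftrightarrow> odd (card {i\<in>{..<n}. \<sigma> (row_var i) \<and> \<sigma> (col_var (partner n s i))})"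
      by (intro shifted_product_fixed_shift[OF s]) simp
    then show "models B (source B) \<sigma> \<longleftrightarrow> odd (card {i\<in>{..<n}. \<sigma> (u i) \<and> \<sigma> (v i)})"
      using uv B(3) by (auto simp: conj_commute)
  next
    show "inj_on u {..<n}" "inj_on v {..<n}" 
      using uv s by (auto simp: inj_on_def partner_eq_iff)
  qed (use uv I in auto)
  consider "n \<le> 2 * card X" | "n \<le> 2 * card Y" using cXY by linarith
  then show ?thesis
  proof cases
    case 1
    obtain s where s: "s < n" and c: "card X * card ({..<n} - Y) \<le> n * card {i\<in>X. partner n s i \<in> {..<n} - Y}"
      using exists_shift_many_partners[OF XY(1) _ n, of "{..<n} - Y"] by blast
    let ?I = "{i\<in>X. partner n s i \<in> {..<n} - Y}"
    \<comment> \<open>The prefix holds \<open>n\<close> row and column variables in all, so it omits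
      as many columns as it contains rows.\<close>
    have "card ({..<n} - Y) = card X" using XY cXY by (simp add: card_Diff_subset)
    then have "card X * card X \<le> n * card ?I" using c by simp
    moreover have "n * n \<le> 4 * (card X * card X)" using mult_le_mono[OF 1 1] by simp
    ultimately have "n * n \<le> n * (4 * card ?I)" by linarith
    then have "n \<le> 4 * card ?I" using n by (simp only: mult_le_cancel1 order_less_imp_le)
    moreover have "2 ^ (card ?I - 1) \<le> bdd_size B"
      by (rule size[OF s, of row_var "col_var \<circ> partner n s"]) (auto simp: X_def Y_def)
    ultimately show ?thesis by blast
  next
    \<comment> \<open>The mirror image: columns lie inside \<open>P\<close> and their partner rows
      outside.\<close>
    case 2
    obtain s where s: "s < n" and c: "card ({..<n} - X) * card Y \<le> n * card {i\<in>{..<n} - X. partner n s i \<in> Y}"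
      using exists_shift_many_partners[OF _ XY(2) n, of "{..<n} - X"] by blast
    let ?I = "{i\<in>{..<n} - X. partner n s i \<in> Y}"
    have "card ({..<n} - X) = card Y" using XY cXY by (simp add: card_Diff_subset)
    then have "card Y * card Y \<le> n * card ?I" using c by simp
    moreover have "n * n \<le> 4 * (card Y * card Y)" using mult_le_mono[OF 2 2] by simp
    ultimately have "n * n \<le> n * (4 * card ?I)" by linarith
    then have "n \<le> 4 * card ?I" using n by (simp only: mult_le_cancel1 order_less_imp_le)
    moreover have "2 ^ (card ?I - 1) \<le> bdd_size B"
      by (rule size[OF s, of "col_var \<circ> partner n s" row_var]) (auto simp: X_def Y_def)
    ultimately show ?thesis by blast
  qed
qed

section \<open>The separation\<close>

theorem theorem2:
  "\<exists>\<Phi> :: nat cnf set.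
     (\<forall>\<phi>\<in>\<Phi>. is_cnf \<phi>) \<and>
     infinite \<Phi> \<and> infinite ((\<lambda>\<phi>. card (cnf_vars \<phi>)) ` \<Phi>) \<and>
     (\<exists>p :: nat poly. \<forall>\<phi>\<in>\<Phi>. \<exists>B :: (nat, nat) bdd.
        fbdd B \<and> represents B (cnf_fun \<phi>) \<and> bdd_size B \<le> poly p (card (cnf_vars \<phi>))) \<and>
     (\<exists>c d :: real. 0 < c \<and> 0 < d \<and>
        (\<forall>\<phi>\<in>\<Phi>. \<forall>B :: (nat, nat) bdd.
           and_obdd B \<and> represents B (cnf_fun \<phi>) \<longrightarrow>
           real (bdd_size B) \<ge> 2 powr (d * real (card (cnf_vars \<phi>)) powr c)))"
proof -
  define F where "F n = canonical_cnf {..<3 * n} (shifted_product n)" for n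
  have cnf: "is_cnf (F n)" for n by (simp add: F_def is_cnf_canonical_cnf)
  have vars: "cnf_vars (F n) = {..<3 * n}" for n
    unfolding F_def by (rule cnf_vars_canonical_cnf[of _ "\<lambda>_. False"]) (simp add: shifted_from_def)
  have sat: "sat_cnf \<sigma> (F n) \<longleftrightarrow> shifted_product n \<sigma>" for n \<sigma>
    unfolding F_def by (rule sat_canonical_cnf) (rule shifted_product_cong, simp)
  have rep: "represents B (cnf_fun (F n)) \<longleftrightarrow>
      bdd_vars B = {..<3 * n} \<and> (\<forall>\<sigma>. models B (source B) \<sigma> \<longleftrightarrow> shifted_product n \<sigma>)"
    if "and_fbdd B" for B :: "(nat, nat) bdd" and n
    using that by (subst represents_cnf_iff) (simp_all add: and_fbdd_def vars sat)
  have inf: "infinite ((\<lambda>\<phi>. card (cnf_vars \<phi>)) ` F ` {8..})"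
  proof -
    have "inj_on (\<lambda>n. 3 * n :: nat) {8..}" by (simp add: inj_on_def)
    then show ?thesis
      by (simp add: image_image vars finite_image_iff infinite_Ici)
  qed
  have upper: "\<exists>B :: (nat, nat) bdd. fbdd B \<and> represents B (cnf_fun (F n)) \<and>
      bdd_size B \<le> poly [:2, 1, 4:] (card (cnf_vars (F n)))" if "8 \<le> n" for n
  proof -
    have "0 < n" using that by simp
    from shifted_product_fbdd[OF this]
    obtain B :: "(nat, nat) bdd" where B: "fbdd B" "bdd_size B \<le> 2 + n + 4 * n\<^sup>2"
      "bdd_vars B = {..<3 * n}" "\<And>\<sigma>. models B (source B) \<sigma> \<longleftrightarrow> shifted_product n \<sigma>"
      by blast
    \<comment> \<open>The bound in \<open>n\<close> is read as a polynomial in the number of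
      variables \<open>3 * n\<close>, which only makes it larger.\<close>
    have "bdd_size B \<le> poly [:2, 1, 4:] (card (cnf_vars (F n)))"
      using B(2) by (simp add: vars power2_eq_square algebra_simps)
    with B rep[of B n] show ?thesis by (auto simp: fbdd_def)
  qed
  have lower: "2 powr (1 / 24 * real (card (cnf_vars (F n))) powr 1) \<le> real (bdd_size B)"
    if n: "8 \<le> n" and B: "and_obdd B" "represents B (cnf_fun (F n))" for n and B :: "(nat, nat) bdd"
  proof -
    have "and_fbdd B" using B(1) by (simp add: and_obdd_def)
    then obtain m where m: "n \<le> 4 * m" "2 ^ (m - 1) \<le> bdd_size B"
      using shifted_product_and_obdd_size[OF B(1), of n] rep[of B n] B(2) n by auto
    \<comment> \<open>The factor \<open>1 / 24\<close> turns the \<open>3 * n\<close> variables into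
      the exponent \<open>n / 8\<close>.\<close>
    have "2 powr (1 / 24 * real (card (cnf_vars (F n))) powr 1) = 2 powr (real n / 8)"
      by (simp add: vars)
    \<comment> \<open>From \<open>m \<ge> n / 4\<close>, subtracting one leaves at least
      \<open>n / 8\<close> once \<open>n \<ge> 8\<close>; this is why the class starts at
      \<open>8\<close>.\<close>
    also have "\<dots> \<le> 2 powr real (m - 1)"
      using m(1) n by (intro powr_mono) (auto simp: of_nat_diff)
    also have "\<dots> = real (2 ^ (m - 1))" by (simp add: powr_realpow)
    also have "\<dots> \<le> real (bdd_size B)" using m(2) by (rule of_nat_mono)
    finally show ?thesis .
  qed
  show ?thesis
  proof (intro exI[of _ "F ` {8..}"] conjI)
    show "infinite (F ` {8..})" using inf by (meson finite_imageI)
    show "\<exists>p :: nat poly. \<forall>\<phi>\<in>F ` {8..}. \<exists>B :: (nat, nat) bdd.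
        fbdd B \<and> represents B (cnf_fun \<phi>) \<and> bdd_size B \<le> poly p (card (cnf_vars \<phi>))"
      by (intro exI[of _ "[:2, 1, 4:]"]) (use upper in auto)
    show "\<exists>c d :: real. 0 < c \<and> 0 < d \<and>
        (\<forall>\<phi>\<in>F ` {8..}. \<forall>B :: (nat, nat) bdd.
           and_obdd B \<and> represents B (cnf_fun \<phi>) \<longrightarrow>
           real (bdd_size B) \<ge> 2 powr (d * real (card (cnf_vars \<phi>)) powr c))"
      by (intro exI[of _ 1] exI[of _ "1 / 24"]) (use lower in auto)
  qed (use cnf inf in auto)
qed

end
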